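(* Let $M_G$ be a mixed graph with vertex set $V$ and edge set $E$, and let $V_1\subseteq V$ be nonempty. Then \[\det(Q[V_1])=\sum_{M_R}3^{\tau_1}4^{\tau_2},\] where the sum runs over all substructures $M_R$ with vertex set $V_1$ (i.e. over all edge subsets $E_1\subseteq E$ with $|E_1|=|V_1|$) that are substructures of type II, and $\tau_1$, $\tau_2$ are the numbers of components of $M_R$ that are unicyclic graphs belonging to $\Psi_2$ and to $\Psi_3$, respectively. Here $Q[V_1]$ is the principal submatrix of $Q(M_G)$ with rows and columns indexed by $V_1$.
   Context: All graphs are simple, finite and connected. A mixed graph $M_G$ is obtained from a graph $G$ (its underlying graph) by giving directions to some edges. Let $\omega=\frac{1+\sqrt{3}\mathbf{i}}{2}$. $N(M_G)=(n_{ij})$ has $n_{ij}=1$ if $v_i,v_j$ are joined by an undirected edge, $n_{ij}=\omega$ if there is an edge directed $v_i\to v_j$, $n_{ij}=\overline{\omega}$ if directed $v_j\to v_i$, and $0$ otherwise; $Q(M_G)=D(M_G)+N(M_G)$ where $D(M_G)$ is the degree diagonal matrix of $G$. A substructure $M_R$ with vertex subset $V_1\subseteq V$ and edge subset $E_1\subseteq E$ consists of these vertices and edges (an edge of $E_1$ may have one or no endpoint in $V_1$); it is square if $|V_1|=|E_1|$. Its components are the connected pieces of the structure with vertices $V_1$ and edges $E_1$, where each edge of $E_1$ joins those of its endpoints lying in $V_1$ (an edge with no endpoint in $V_1$ is a component on its own). A component is a rootless tree if it is obtained from a tree by deleting one vertex (the root) while keeping the incident edge as an edge with only one endpoint; equivalently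 its edges with both endpoints in $V_1$ form a tree on its vertices and it contains exactly one edge of $E_1$ with exactly one endpoint in $V_1$. A component is a unicyclic graph if all its edges have both endpoints in $V_1$ and it is a connected graph with exactly one cycle. For a mixed cycle, fix a cyclic traversal direction; let $a$ (resp. $b$) be the number of directed edges oriented along (resp. against) the traversal, and $c$ the number of undirected edges. The cycle belongs to $\Psi_1$ if $a-b\equiv 1,2,4$ or $5\pmod 6$ and $c$ is odd; to $\Psi_2$ if $a-b\equiv 1,2,4$ or $5\pmod 6$ and $c$ is even; to $\Psi_3$ if $a-b\equiv 0$ or $3\pmod 6$ and $c$ is odd; to $\Psi_4$ if $a-b\equiv 0$ or $3\pmod 6$ and $c$ is even. A unicyclic mixed graph belongs to the class of its cycle. A square substructure is of type II if each of its components is either a rootless tree or a unicyclic graph not belonging to $\Psi_4$. *)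

theory Defs
  imports Complex_Main "Jordan_Normal_Form.Determinant" "Jordan_Normal_Form.DL_Submatrix"
begin

section \<open>Graphs, cycles, trees\<close>

text \<open>Edges are two-element vertex sets. A graph is given by its vertex set and its edge set.\<close>

definition connected_graph :: "'v set \<Rightarrow> 'v set set \<Rightarrow> bool" where
  "connected_graph W F \<longleftrightarrow>
     W \<noteq> {} \<and> (\<forall>u\<in>W. \<forall>v\<in>W. (u, v) \<in> {(x, y). {x, y} \<in> F}\<^sup>*)"

text \<open>The vertex following position \<open>i\<close> on a cyclic traversal.\<close>

definition cyc_succ :: "'v list \<Rightarrow> nat \<Rightarrow> 'v" where
  "cyc_succ cs i = cs ! (Suc i mod length cs)"

text \<open>A list is a cyclic traversal of a cycle: start vertex and direction are part of the list.
  The cycle itself, as a subgraph, is determined by its set of edges.\<close>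

definition cycle_traversal :: "'v set set \<Rightarrow> 'v list \<Rightarrow> bool" where
  "cycle_traversal F cs \<longleftrightarrow>
     3 \<le> length cs \<and> distinct cs \<and> (\<forall>i<length cs. {cs ! i, cyc_succ cs i} \<in> F)"

definition traversal_edges :: "'v list \<Rightarrow> 'v set set" where
  "traversal_edges cs = {{cs ! i, cyc_succ cs i} | i. i < length cs}"

definition cycles :: "'v set set \<Rightarrow> 'v set set set" where
  "cycles F = {traversal_edges cs | cs. cycle_traversal F cs}"

definition tree_graph :: "'v set \<Rightarrow> 'v set set \<Rightarrow> bool" where
  "tree_graph W F \<longleftrightarrow> connected_graph W F \<and> cycles F = {}"


section \<open>Mixed graphs and their matrices\<close>

text \<open>\<open>(V, E)\<close> is the underlying graph; \<open>(u, v) \<in> A\<close> means that the edge \<open>{u, v}\<close> has been given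
  the direction from \<open>u\<close> to \<open>v\<close>. Edges with no direction in \<open>A\<close> are undirected.\<close>

locale mixed_graph =
  fixes V :: "'v set" and E :: "'v set set" and A :: "('v \<times> 'v) set"
  assumes finite_verts: "finite V"
    and edges_simple: "e \<in> E \<Longrightarrow> e \<subseteq> V \<and> card e = 2"
    and connected: "connected_graph V E"
    and arcs_edges: "(u, v) \<in> A \<Longrightarrow> {u, v} \<in> E"
    and arcs_one_direction: "(u, v) \<in> A \<Longrightarrow> (v, u) \<notin> A"

definition omega :: complex where
  "omega = (1 + complex_of_real (sqrt 3) * \<i>) / 2"

definition N_entry :: "'v set set \<Rightarrow> ('v \<times> 'v) set \<Rightarrow> 'v \<Rightarrow> 'v \<Rightarrow> complex" where
  "N_entry E A u v =
     (if (u, v) \<in> A then omega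
      else if (v, u) \<in> A then cnj omega
      else if {u, v} \<in> E then 1
      else 0)"

definition degree_of :: "'v set set \<Rightarrow> 'v \<Rightarrow> nat" where
  "degree_of E v = card {e \<in> E. v \<in> e}"

text \<open>The list \<open>vs\<close> enumerates the vertices and thereby fixes the indexing of rows and columns.\<close>

definition N_mat :: "'v list \<Rightarrow> 'v set set \<Rightarrow> ('v \<times> 'v) set \<Rightarrow> complex mat" where
  "N_mat vs E A = mat (length vs) (length vs) (\<lambda>(i, j). N_entry E A (vs ! i) (vs ! j))"

definition D_mat :: "'v list \<Rightarrow> 'v set set \<Rightarrow> complex mat" where
  "D_mat vs E = mat_diag (length vs) (\<lambda>i. of_nat (degree_of E (vs ! i)))"

definition Q_mat :: "'v list \<Rightarrow> 'v set set \<Rightarrow> ('v \<times> 'v) set \<Rightarrow> complex mat" where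
  "Q_mat vs E A = D_mat vs E + N_mat vs E A"

definition principal_submatrix :: "'v list \<Rightarrow> 'a mat \<Rightarrow> 'v set \<Rightarrow> 'a mat" where
  "principal_submatrix vs M W =
     (let I = {i. i < length vs \<and> vs ! i \<in> W} in submatrix M I I)"


section \<open>The classes of mixed cycles\<close>

definition num_along :: "('v \<times> 'v) set \<Rightarrow> 'v list \<Rightarrow> nat" where
  "num_along A cs = card {i. i < length cs \<and> (cs ! i, cyc_succ cs i) \<in> A}"

definition num_against :: "('v \<times> 'v) set \<Rightarrow> 'v list \<Rightarrow> nat" where
  "num_against A cs = card {i. i < length cs \<and> (cyc_succ cs i, cs ! i) \<in> A}"

definition num_undirected :: "('v \<times> 'v) set \<Rightarrow> 'v list \<Rightarrow> nat" where
  "num_undirected A cs =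
     card {i. i < length cs \<and> (cs ! i, cyc_succ cs i) \<notin> A \<and> (cyc_succ cs i, cs ! i) \<notin> A}"

definition flow :: "('v \<times> 'v) set \<Rightarrow> 'v list \<Rightarrow> int" where
  "flow A cs = int (num_along A cs) - int (num_against A cs)"

definition Psi1 :: "('v \<times> 'v) set \<Rightarrow> 'v list set" where
  "Psi1 A = {cs. flow A cs mod 6 \<in> {1, 2, 4, 5} \<and> odd (num_undirected A cs)}"

definition Psi2 :: "('v \<times> 'v) set \<Rightarrow> 'v list set" where
  "Psi2 A = {cs. flow A cs mod 6 \<in> {1, 2, 4, 5} \<and> even (num_undirected A cs)}"

definition Psi3 :: "('v \<times> 'v) set \<Rightarrow> 'v list set" where
  "Psi3 A = {cs. flow A cs mod 6 \<in> {0, 3} \<and> odd (num_undirected A cs)}"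

definition Psi4 :: "('v \<times> 'v) set \<Rightarrow> 'v list set" where
  "Psi4 A = {cs. flow A cs mod 6 \<in> {0, 3} \<and> even (num_undirected A cs)}"


section \<open>Substructures\<close>

text \<open>A substructure is a pair of a vertex set and an edge set, where edges need not have their
  endpoints in the vertex set. Its connected pieces are the classes of the equivalence relation
  generated, on the disjoint union of vertices and edges, by incidence. An edge without
  endpoint in \<open>W\<close> is thus a class on its own, as is a vertex without incident edge in \<open>F\<close>.\<close>

definition incidence :: "'v set \<Rightarrow> 'v set set \<Rightarrow> ('v + 'v set) rel" where
  "incidence W F = {(Inl v, Inr e) | v e. v \<in> W \<and> e \<in> F \<and> v \<in> e}"

definition components :: "'v set \<Rightarrow> 'v set set \<Rightarrow> ('v set \<times> 'v set set) set" where
  "components W F =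
     (\<lambda>K. (Inl -` K, Inr -` K)) `
       ((W <+> F) // ((incidence W F \<union> (incidence W F)\<inverse>)\<^sup>*))"

text \<open>The next notions are applied to components. For an edge of a component, the endpoints in
  the vertex set of the component are its endpoints in the vertex set of the whole
  substructure.\<close>

definition rootless_tree :: "'v set \<times> 'v set set \<Rightarrow> bool" where
  "rootless_tree K \<longleftrightarrow>
     (case K of (W, F) \<Rightarrow>
        tree_graph W {e \<in> F. e \<subseteq> W} \<and> (\<exists>!e. e \<in> F \<and> card (e \<inter> W) = 1))"

definition unicyclic :: "'v set \<times> 'v set set \<Rightarrow> bool" where
  "unicyclic K \<longleftrightarrow>
     (case K of (W, F) \<Rightarrow>
        (\<forall>e\<in>F. e \<subseteq> W) \<and> connected_graph W F \<and> (\<exists>!C. C \<in> cycles F))"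

text \<open>The unicyclic graph belongs to the class \<open>P\<close> of its cycle. The existential quantifier only
  chooses a traversal of the unique cycle; changing the start vertex or the direction leaves
  the number of undirected edges and the value of \<open>flow\<close> up to sign unchanged, hence also
  membership in each of the four classes.\<close>

definition unicyclic_in :: "'v list set \<Rightarrow> 'v set \<times> 'v set set \<Rightarrow> bool" where
  "unicyclic_in P K \<longleftrightarrow> unicyclic K \<and> (\<exists>cs. cycle_traversal (snd K) cs \<and> cs \<in> P)"

definition square_substructure :: "'v set \<Rightarrow> 'v set set \<Rightarrow> bool" where
  "square_substructure W F \<longleftrightarrow> card W = card F"

definition type_II :: "('v \<times> 'v) set \<Rightarrow> 'v set \<Rightarrow> 'v set set \<Rightarrow> bool" where
  "type_II A W F \<longleftrightarrow>
     square_substructure W F \<and>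
     (\<forall>K\<in>components W F. rootless_tree K \<or> (unicyclic K \<and> \<not> unicyclic_in (Psi4 A) K))"

definition tau1 :: "('v \<times> 'v) set \<Rightarrow> 'v set \<Rightarrow> 'v set set \<Rightarrow> nat" where
  "tau1 A W F = card {K \<in> components W F. unicyclic_in (Psi2 A) K}"

definition tau2 :: "('v \<times> 'v) set \<Rightarrow> 'v set \<Rightarrow> 'v set set \<Rightarrow> nat" where
  "tau2 A W F = card {K \<in> components W F. unicyclic_in (Psi3 A) K}"

end

theory Submission
  imports Defs
begin

text \<open>
  The matrix \<open>Q\<close> factors as \<open>S S\<^sup>*\<close>, where the vertex-edge matrix \<open>S\<close> has entries of modulus 1
  exactly at incidences, so by Cauchy--Binet \<open>det Q[V1]\<close> is the sum of \<open>|det S[V1, E1]|\<^sup>2\<close> over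
  all edge sets \<open>E1\<close> with as many elements as \<open>V1\<close>. These squared moduli are multiplicative over
  components and vanish unless every component has as many edges as vertices, which for a
  connected piece means being a rootless tree or unicyclic. Pairing each vertex with the first
  edge on its way to the root, respectively to the cycle, makes the matrix block triangular, so
  that only the pendant edge, respectively the cycle, contributes. The matrix of a cycle is
  bidiagonal up to one corner entry; its squared modulus is
  \<open>|1 - (-1)\<^sup>n \<omega>\<^sup>f|\<^sup>2 = |1 - (-1)\<^sup>c (- \<omega>)\<^sup>f|\<^sup>2\<close> for length \<open>n\<close>, flow \<open>f\<close> and \<open>c\<close> undirected edges.
  Since \<open>- \<omega>\<close> is a primitive third root of unity, only \<open>f\<close> modulo 3 matters.
\<close>

section \<open>Determinants indexed by finite sets\<close>

definition det_on :: "'v set \<Rightarrow> ('v \<Rightarrow> 'v \<Rightarrow> 'a::comm_ring_1) \<Rightarrow> 'a" where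
  "det_on W a = (\<Sum>p | p permutes W. of_int (sign p) * (\<Prod>v\<in>W. a v (p v)))"

lemma det_on_cong: "(\<And>u v. u \<in> W \<Longrightarrow> v \<in> W \<Longrightarrow> a u v = b u v) \<Longrightarrow> det_on W a = det_on W b"
  unfolding det_on_def
  by (intro sum.cong refl arg_cong2[where f = "(*)"] prod.cong) (auto simp: permutes_in_image)

lemma det_on_reindex:
  assumes bij: "bij_betw b I W" and fin: "finite I"
  shows "det_on I (\<lambda>i j. a (b i) (b j)) = det_on W a"
  unfolding det_on_def
proof (rule sum.reindex_bij_witness
    [where j = "map_permutation I b" and i = "map_permutation W (inv_into I b)"])
  have inj: "inj_on b I" using bij by (rule bij_betw_imp_inj_on)
  fix p assume "p \<in> {p. p permutes I}"
  then have perm: "p permutes I" by simp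
  show "map_permutation W (inv_into I b) (map_permutation I b p) = p"
    using map_permutation_compose_inv[OF bij perm] inv_into_f_f[OF inj] by blast
  show "map_permutation I b p \<in> {p. p permutes W}"
    using map_permutation_permutes[OF bij perm] by simp
  have "(\<Prod>v\<in>W. a v (map_permutation I b p v)) = (\<Prod>i\<in>I. a (b i) (map_permutation I b p (b i)))"
    by (rule prod.reindex_bij_betw[OF bij, symmetric])
  also have "\<dots> = (\<Prod>i\<in>I. a (b i) (b (p i)))"
    by (intro prod.cong refl) (simp add: map_permutation_apply[OF inj])
  finally show "of_int (sign (map_permutation I b p)) * (\<Prod>v\<in>W. a v (map_permutation I b p v))
      = of_int (sign p) * (\<Prod>i\<in>I. a (b i) (b (p i)))"
    by (simp add: sign_map_permutation[OF inj perm fin])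
next
  fix p assume "p \<in> {p. p permutes W}"
  then have perm: "p permutes W" by simp
  have bij_inv: "bij_betw (inv_into I b) W I" using bij_betw_inv_into[OF bij] .
  show "map_permutation I b (map_permutation W (inv_into I b) p) = p"
    using map_permutation_compose_inv[OF bij_inv perm] bij_betw_inv_into_right[OF bij] by blast
  show "map_permutation W (inv_into I b) p \<in> {p. p permutes I}"
    using map_permutation_permutes[OF bij_inv perm] by simp
qed

lemma det_on_atLeastLessThan: "det_on {0..<n} a = det (mat n n (\<lambda>(i, j). a i j))"
  unfolding det_on_def det_def'[OF mat_carrier]
  by (intro sum.cong refl arg_cong2[where f = "(*)"] prod.cong)
    (auto simp: permutes_in_image[of _ "{0..<n}"])

lemma det_on_eq_det:
  assumes "bij_betw b {0..<n} W"
  shows "det_on W a = det (mat n n (\<lambda>(i, j). a (b i) (b j)))"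
  by (simp add: det_on_reindex[OF assms, of a] flip: det_on_atLeastLessThan)

lemma det_on_transpose:
  assumes "finite W"
  shows "det_on W (\<lambda>u v. a v u) = det_on W a"
proof -
  obtain b where enum: "bij_betw b {0..<card W} W" using ex_bij_betw_nat_finite[OF assms] by blast
  let ?A = "mat (card W) (card W) (\<lambda>(i, j). a (b i) (b j))"
  have "transpose_mat ?A = mat (card W) (card W) (\<lambda>(i, j). a (b j) (b i))" by (rule eq_matI) auto
  then show ?thesis using det_transpose[of ?A "card W"] by (simp add: det_on_eq_det[OF enum])
qed

lemma det_on_permute_columns:
  assumes "finite W" "q permutes W"
  shows "det_on W (\<lambda>u v. a u (q v)) = of_int (sign q) * det_on W a"
proof -
  have "sign (q \<circ> p) = sign q * sign p" if "p permutes W" for p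
    using assms that permutation_permutes by (intro sign_compose) blast+
  then have "det_on W a
      = (\<Sum>p | p permutes W. of_int (sign q) * (of_int (sign p) * (\<Prod>v\<in>W. a v (q (p v)))))"
    unfolding det_on_def
    by (subst setum_permutations_compose_left[OF assms(2)]) (auto intro!: sum.cong simp: mult.assoc)
  also have "\<dots> = of_int (sign q) * det_on W (\<lambda>u v. a u (q v))"
    by (simp add: det_on_def sum_distrib_left)
  finally show ?thesis by (simp flip: mult.assoc of_int_mult)
qed

lemma det_on_permute_rows:
  assumes "finite W" "q permutes W"
  shows "det_on W (\<lambda>u v. a (q u) v) = of_int (sign q) * det_on W a"
  using det_on_permute_columns[OF assms, of "\<lambda>u v. a v u"]
  by (simp add: det_on_transpose[OF assms(1), of a] det_on_transpose[OF assms(1), of "\<lambda>u. a (q u)"])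

lemma det_on_identical_rows:
  assumes "finite W" "x \<in> W" "y \<in> W" "x \<noteq> y" "\<And>v. v \<in> W \<Longrightarrow> a x v = a y v"
  shows "det_on W a = 0"
proof -
  obtain b where enum: "bij_betw b {0..<card W} W"
    using ex_bij_betw_nat_finite[OF assms(1)] by blast
  let ?A = "mat (card W) (card W) (\<lambda>(i, j). a (b i) (b j))"
  have "x \<in> b ` {0..<card W}" "y \<in> b ` {0..<card W}"
    using enum assms(2,3) by (auto simp: bij_betw_def)
  then obtain i j where indices: "i < card W" "j < card W" "x = b i" "y = b j" by auto
  have "row ?A i = row ?A j"
    using indices assms(5) bij_betwE[OF enum] by (intro eq_vecI) auto
  moreover have "i \<noteq> j" using indices(3,4) assms(4) by blast
  ultimately have "det ?A = 0"
    using indices(1,2) by (intro det_identical_rows[of _ "card W" i j]) auto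
  then show ?thesis by (simp add: det_on_eq_det[OF enum])
qed

lemma det_on_eq_0_if_zero_block:
  assumes fin: "finite W" and sub: "R \<subseteq> W" "C \<subseteq> W" and large: "card W < card R + card C"
    and zero: "\<And>u v. u \<in> R \<Longrightarrow> v \<in> C \<Longrightarrow> a u v = 0"
  shows "det_on W a = 0"
proof -
  have "(\<Prod>v\<in>W. a v (p v)) = 0" if perm: "p permutes W" for p
  proof (rule ccontr)
    assume "(\<Prod>v\<in>W. a v (p v)) \<noteq> 0"
    then have nonzero: "a v (p v) \<noteq> 0" if "v \<in> W" for v
      using that prod_zero[OF fin, of "\<lambda>v. a v (p v)"] by blast
    have "p ` R \<subseteq> W - C"
      using zero nonzero sub permutes_in_image[OF perm] by blast
    then have "card R \<le> card (W - C)"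
      using fin by (intro card_inj_on_le[OF permutes_inj_on[OF perm]]) auto
    also have "\<dots> = card W - card C" using sub fin by (simp add: card_Diff_subset finite_subset)
    finally show False using large card_mono[OF fin sub(2)] by linarith
  qed
  then show ?thesis by (simp add: det_on_def)
qed

lemma det_on_block_triangular:
  fixes a :: "'v \<Rightarrow> 'v \<Rightarrow> 'a::idom"
  assumes fin: "finite W1" "finite W2" and disj: "W1 \<inter> W2 = {}"
    and zero: "\<And>u v. u \<in> W2 \<Longrightarrow> v \<in> W1 \<Longrightarrow> a u v = 0"
  shows "det_on (W1 \<union> W2) a = det_on W1 a * det_on W2 a"
proof -
  let ?m = "card W1" and ?n = "card W2"
  obtain b1 b2 where enum1: "bij_betw b1 {0..<?m} W1" and enum2: "bij_betw b2 {0..<?n} W2"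
    using fin ex_bij_betw_nat_finite by metis
  define b where "b i = (if i < ?m then b1 i else b2 (i - ?m))" for i
  define B where "B k l r s = mat k l (\<lambda>(i, j). a (b (r + i)) (b (s + j)))" for k l r s
  have "bij_betw b {0..<?m} W1"
    by (rule iffD2[OF bij_betw_cong enum1]) (simp add: b_def)
  moreover have "bij_betw b {?m..<?m + ?n} W2"
  proof -
    have "bij_betw (\<lambda>i. i - ?m) {?m..<?m + ?n} {0..<?n}"
      by (rule bij_betwI[where g = "\<lambda>i. ?m + i"]) auto
    from bij_betw_trans[OF this enum2] show ?thesis
      by (rule iffD1[OF bij_betw_cong, rotated]) (simp add: b_def)
  qed
  ultimately have enum: "bij_betw b {0..<?m + ?n} (W1 \<union> W2)"
    using bij_betw_combine[of b "{0..<?m}" W1 "{?m..<?m + ?n}" W2] disj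
    by (simp add: ivl_disj_un_two(3))
  have in_W: "i < ?m \<Longrightarrow> b i \<in> W1" "?m \<le> i \<Longrightarrow> i < ?m + ?n \<Longrightarrow> b i \<in> W2" for i
    using bij_betwE[OF enum1] bij_betwE[OF enum2] by (auto simp: b_def)
  have "mat (?m + ?n) (?m + ?n) (\<lambda>(i, j). a (b i) (b j))
      = four_block_mat (B ?m ?m 0 0) (B ?m ?n 0 ?m) (0\<^sub>m ?n ?m) (B ?n ?n ?m ?m)"
    using zero in_W by (intro eq_matI) (auto simp: B_def)
  then have "det_on (W1 \<union> W2) a = det (B ?m ?m 0 0) * det (B ?n ?n ?m ?m)"
    unfolding det_on_eq_det[OF enum]
    by (simp add: det_four_block_mat_lower_left_zero[where n = ?m and m = ?n] B_def)
  also have "B ?m ?m 0 0 = mat ?m ?m (\<lambda>(i, j). a (b1 i) (b1 j))"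
    by (rule eq_matI) (auto simp: B_def b_def)
  also have "B ?n ?n ?m ?m = mat ?n ?n (\<lambda>(i, j). a (b2 i) (b2 j))"
    by (rule eq_matI) (auto simp: B_def b_def)
  finally show ?thesis by (simp add: det_on_eq_det[OF enum1] det_on_eq_det[OF enum2])
qed

lemma permutes_nondecreasing_imp_eq:
  fixes d :: "'v \<Rightarrow> nat"
  assumes "finite W" "p permutes W" "\<And>v. v \<in> W \<Longrightarrow> d v \<le> d (p v)" "v \<in> W"
  shows "d (p v) = d v"
proof -
  have "(\<Sum>v\<in>W. d v) = (\<Sum>v\<in>W. d (p v))"
    using sum.permute[OF assms(2), of d] by (simp add: o_def)
  then show ?thesis using sum_mono_inv[of d W "\<lambda>v. d (p v)" v] assms by simp
qed

lemma det_on_triangular: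
  fixes d :: "'v \<Rightarrow> nat"
  assumes fin: "finite W"
    and tri: "\<And>u v. u \<in> W \<Longrightarrow> v \<in> W \<Longrightarrow> u \<noteq> v \<Longrightarrow> a u v \<noteq> 0 \<Longrightarrow> d u < d v"
  shows "det_on W a = (\<Prod>v\<in>W. a v v)"
proof -
  have only_id: "p = id" if perm: "p permutes W" and "(\<Prod>v\<in>W. a v (p v)) \<noteq> 0" for p
  proof -
    have nonzero: "a v (p v) \<noteq> 0" if "v \<in> W" for v
      using \<open>(\<Prod>v\<in>W. a v (p v)) \<noteq> 0\<close> that prod_zero[OF fin, of "\<lambda>v. a v (p v)"] by blast
    have step: "p v = v \<or> d v < d (p v)" if "v \<in> W" for v
      using tri[of v "p v"] nonzero that permutes_in_image[OF perm] by metis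
    then have "d (p v) = d v" if "v \<in> W" for v
      using permutes_nondecreasing_imp_eq[OF fin perm, of d] that by (metis le_refl less_imp_le)
    then have "p v = v" for v using step permutes_not_in[OF perm] by (metis less_irrefl)
    then show ?thesis by auto
  qed
  have "det_on W a = (\<Sum>p\<in>{id}. of_int (sign p) * (\<Prod>v\<in>W. a v (p v)))"
    unfolding det_on_def using fin
    by (intro sum.mono_neutral_right) (auto simp: finite_permutations permutes_id intro: only_id)
  then show ?thesis by simp
qed

lemma det_cyclic_bidiagonal:
  fixes A :: "'a::comm_ring_1 mat"
  assumes carrier: "A \<in> carrier_mat n n" and n_ge_2: "2 \<le> n"
    and zero: "\<And>i j. i < n \<Longrightarrow> j < n \<Longrightarrow> i \<noteq> j \<Longrightarrow> i \<noteq> Suc j mod n \<Longrightarrow> A $$ (i, j) = 0"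
  shows "det A = (\<Prod>i<n. A $$ (i, i)) + (- 1) ^ (n - 1) * (\<Prod>i<n. A $$ (Suc i mod n, i))"
proof -
  obtain m where n_eq: "n = Suc m" "0 < m" using n_ge_2 by (cases n) auto
  let ?A0 = "mat_delete A 0 0" and ?Am = "mat_delete A 0 m"
  have "A $$ (0, j) * cofactor A 0 j = 0" if "j \<in> {..<n} - {0, m}" for j
    using that zero[of 0 j] n_eq by simp
  then have "det A = (\<Sum>j\<in>{0, m}. A $$ (0, j) * cofactor A 0 j)"
    unfolding laplace_expansion_row[OF carrier, of 0, OF less_le_trans[OF zero_less_numeral n_ge_2]]
    using n_eq by (intro sum.mono_neutral_right) auto
  then have expand: "det A = A $$ (0, 0) * det ?A0 + (- 1) ^ m * (A $$ (0, m) * det ?Am)"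
    using n_eq by (simp add: cofactor_def mult.left_commute)
  have "?A0 $$ (i, j) = 0" if "i < j" "j < m" for i j
    using that carrier n_eq zero[of "Suc i" "Suc j"] by (simp add: mat_delete_def mod_Suc)
  then have "det ?A0 = prod_list (diag_mat ?A0)"
    using mat_delete_carrier[OF carrier, of 0 0] n_eq by (intro det_lower_triangular[of m]) auto
  then have det0: "det ?A0 = (\<Prod>i<m. A $$ (Suc i, Suc i))"
    using carrier n_eq by (simp add: prod_list_diag_prod mat_delete_def atLeast0LessThan)
  have "upper_triangular ?Am"
    using carrier n_eq zero[of "Suc _"] by (auto simp: mat_delete_def)
  then have "det ?Am = prod_list (diag_mat ?Am)"
    using mat_delete_carrier[OF carrier, of 0 m] n_eq by (intro det_upper_triangular[of _ m]) auto
  then have detm: "det ?Am = (\<Prod>i<m. A $$ (Suc i, i))"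
    using carrier n_eq by (simp add: prod_list_diag_prod mat_delete_def atLeast0LessThan)
  have "(\<Prod>i<n. A $$ (i, i)) = A $$ (0, 0) * det ?A0"
    unfolding det0 n_eq(1) by (rule prod.lessThan_Suc_shift)
  moreover have "(\<Prod>i<n. A $$ (Suc i mod n, i)) = A $$ (0, m) * det ?Am"
    unfolding detm n_eq(1) by (simp add: mult.commute)
  ultimately show ?thesis using expand n_eq(1) by simp
qed

lemma det_on_cyclic_bidiagonal:
  assumes simple: "distinct cs" "2 \<le> length cs"
    and zero: "\<And>i j. i < length cs \<Longrightarrow> j < length cs \<Longrightarrow> i \<noteq> j \<Longrightarrow> i \<noteq> Suc j mod length cs \<Longrightarrow>
      a (cs ! i) (cs ! j) = 0"
  shows "det_on (set cs) a = (\<Prod>i<length cs. a (cs ! i) (cs ! i))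
    + (- 1) ^ (length cs - 1) * (\<Prod>i<length cs. a (cyc_succ cs i) (cs ! i))"
proof -
  let ?n = "length cs" and ?A = "mat (length cs) (length cs) (\<lambda>(i, j). a (cs ! i) (cs ! j))"
  have "bij_betw ((!) cs) {0..<?n} (set cs)"
    using bij_betw_nth[OF simple(1)] by (simp add: atLeast0LessThan)
  then have "det_on (set cs) a = det ?A" by (rule det_on_eq_det)
  also have "\<dots> = (\<Prod>i<?n. ?A $$ (i, i)) + (- 1) ^ (?n - 1) * (\<Prod>i<?n. ?A $$ (Suc i mod ?n, i))"
    by (rule det_cyclic_bidiagonal) (use simple(2) zero in auto)
  also have "(\<Prod>i<?n. ?A $$ (Suc i mod ?n, i)) = (\<Prod>i<?n. a (cyc_succ cs i) (cs ! i))"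
  proof (intro prod.cong refl)
    fix i assume "i \<in> {..<?n}"
    then have "Suc i mod ?n < ?n" by (intro mod_less_divisor) auto
    with \<open>i \<in> {..<?n}\<close> show "?A $$ (Suc i mod ?n, i) = a (cyc_succ cs i) (cs ! i)"
      by (simp add: cyc_succ_def)
  qed
  finally show ?thesis by simp
qed

section \<open>The Cauchy--Binet formula and minors\<close>

lemma bijections_differ_by_permutation:
  assumes bij_f: "bij_betw f W F" and bij_g: "bij_betw g W F"
  obtains q where "q permutes W" "\<And>v. v \<in> W \<Longrightarrow> g v = f (q v)"
proof
  show "restrict_id (inv_into W f \<circ> g) W permutes W"
    using bij_betw_trans[OF bij_g bij_betw_inv_into[OF bij_f]] by (rule permutes_restrict_id)
  show "g v = f (restrict_id (inv_into W f \<circ> g) W v)" if "v \<in> W" for v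
    using that bij_betwE[OF bij_g] by (simp add: bij_betw_inv_into_right[OF bij_f])
qed

lemma bij_betw_permutations_bijections:
  assumes bij_f: "bij_betw f W F"
  shows "bij_betw (\<lambda>q. restrict (f \<circ> q) W) {q. q permutes W} {g \<in> W \<rightarrow>\<^sub>E F. bij_betw g W F}"
proof (rule bij_betw_imageI)
  show "inj_on (\<lambda>q. restrict (f \<circ> q) W) {q. q permutes W}"
  proof (rule inj_onI, rule ext)
    fix p q x
    assume perms: "p \<in> {q. q permutes W}" "q \<in> {q. q permutes W}"
      and eq: "restrict (f \<circ> p) W = restrict (f \<circ> q) W"
    show "p x = q x"
    proof (cases "x \<in> W")
      case True
      then have "f (p x) = f (q x)" using fun_cong[OF eq, of x] by simp
      then show ?thesis
        using bij_f perms True by (auto simp: bij_betw_def inj_on_def permutes_in_image)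
    next
      case False
      then show ?thesis using perms by (simp add: permutes_not_in)
    qed
  qed
  show "(\<lambda>q. restrict (f \<circ> q) W) ` {q. q permutes W} = {g \<in> W \<rightarrow>\<^sub>E F. bij_betw g W F}"
  proof (intro equalityI subsetI)
    fix g assume "g \<in> (\<lambda>q. restrict (f \<circ> q) W) ` {q. q permutes W}"
    then obtain q where perm: "q permutes W" "g = restrict (f \<circ> q) W" by auto
    have "bij_betw g W F"
      using bij_betw_trans[OF permutes_imp_bij[OF perm(1)] bij_f] unfolding perm(2)
      by (simp add: bij_betw_def)
    then show "g \<in> {g \<in> W \<rightarrow>\<^sub>E F. bij_betw g W F}"
      using bij_betwE[of g W F] perm(2) by auto
  next
    fix g assume "g \<in> {g \<in> W \<rightarrow>\<^sub>E F. bij_betw g W F}"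
    then have bij_g: "g \<in> W \<rightarrow>\<^sub>E F" "bij_betw g W F" by auto
    obtain q where perm: "q permutes W" "\<And>v. v \<in> W \<Longrightarrow> g v = f (q v)"
      using bijections_differ_by_permutation[OF bij_f bij_g(2)] by blast
    then have "g = restrict (f \<circ> q) W"
      using bij_g(1) by (auto simp: fun_eq_iff PiE_def extensional_def)
    then show "g \<in> (\<lambda>q. restrict (f \<circ> q) W) ` {q. q permutes W}" using perm(1) by blast
  qed
qed

lemma sum_bijections_eq_product_of_minors:
  assumes fin: "finite W" and bij: "bij_betw f W F"
  shows "(\<Sum>g | g \<in> W \<rightarrow>\<^sub>E F \<and> bij_betw g W F. (\<Prod>v\<in>W. s v (g v)) * det_on W (\<lambda>u. t (g u)))
    = det_on W (\<lambda>u v. s u (f v)) * det_on W (\<lambda>u. t (f u))"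
proof -
  have "det_on W (\<lambda>u. t (restrict (f \<circ> q) W u)) = of_int (sign q) * det_on W (\<lambda>u. t (f u))"
    if "q permutes W" for q
    using det_on_permute_rows[OF fin that, of "\<lambda>u. t (f u)"] by (simp cong: det_on_cong)
  then have "(\<Sum>g | g \<in> W \<rightarrow>\<^sub>E F \<and> bij_betw g W F. (\<Prod>v\<in>W. s v (g v)) * det_on W (\<lambda>u. t (g u)))
    = (\<Sum>q | q permutes W.
        of_int (sign q) * (\<Prod>v\<in>W. s v (f (q v))) * det_on W (\<lambda>u. t (f u)))"
    unfolding sum.reindex_bij_betw[OF bij_betw_permutations_bijections[OF bij], symmetric]
    by (intro sum.cong) (simp_all add: mult_ac)
  then show ?thesis by (simp add: det_on_def flip: sum_distrib_right)
qed

theorem det_on_Cauchy_Binet: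
  fixes s :: "'v \<Rightarrow> 'e \<Rightarrow> 'a::comm_ring_1" and t :: "'e \<Rightarrow> 'v \<Rightarrow> 'a"
  assumes fin: "finite W" "finite E"
    and bij: "\<And>F. F \<subseteq> E \<Longrightarrow> card F = card W \<Longrightarrow> bij_betw (f F) W F"
  shows "det_on W (\<lambda>u v. \<Sum>e\<in>E. s u e * t e v)
    = (\<Sum>F | F \<subseteq> E \<and> card F = card W. det_on W (\<lambda>u v. s u (f F v)) * det_on W (\<lambda>u. t (f F u)))"
proof -
  let ?G = "W \<rightarrow>\<^sub>E E" and ?\<F> = "{F. F \<subseteq> E \<and> card F = card W}"
  let ?h = "\<lambda>g. (\<Prod>v\<in>W. s v (g v)) * det_on W (\<lambda>u. t (g u))"
  have finG: "finite ?G" using fin by (intro finite_PiE) auto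
  have "det_on W (\<lambda>u v. \<Sum>e\<in>E. s u e * t e v)
      = (\<Sum>p | p permutes W. \<Sum>g\<in>?G. of_int (sign p) * (\<Prod>v\<in>W. s v (g v) * t (g v) (p v)))"
    using fin by (simp add: det_on_def prod_sum_PiE sum_distrib_left)
  also have "\<dots> = (\<Sum>g\<in>?G. \<Sum>p | p permutes W. of_int (sign p) * (\<Prod>v\<in>W. s v (g v) * t (g v) (p v)))"
    by (rule sum.swap)
  also have "\<dots> = (\<Sum>g\<in>?G. ?h g)"
    by (simp add: det_on_def sum_distrib_left prod.distrib mult_ac)
  also have "\<dots> = (\<Sum>g | g \<in> ?G \<and> inj_on g W. ?h g)"
  proof (rule sum.mono_neutral_right[OF finG], blast, intro ballI)
    fix g assume "g \<in> ?G - {g. g \<in> ?G \<and> inj_on g W}"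
    then obtain x y where "x \<in> W" "y \<in> W" "x \<noteq> y" "g x = g y" by (auto simp: inj_on_def)
    then have "det_on W (\<lambda>u. t (g u)) = 0"
      using det_on_identical_rows[OF fin(1), of x y "\<lambda>u. t (g u)"] by simp
    then show "?h g = 0" by simp
  qed
  also have "\<dots> = (\<Sum>F\<in>?\<F>. \<Sum>g\<in>{g \<in> {g. g \<in> ?G \<and> inj_on g W}. g ` W = F}. ?h g)"
    using finG fin by (intro sum.group[symmetric]) (auto simp: card_image)
  also have "\<dots> = (\<Sum>F\<in>?\<F>. det_on W (\<lambda>u v. s u (f F v)) * det_on W (\<lambda>u. t (f F u)))"
  proof (intro sum.cong refl)
    fix F assume subset: "F \<in> ?\<F>"
    then have "{g \<in> {g. g \<in> ?G \<and> inj_on g W}. g ` W = F} = {g. g \<in> W \<rightarrow>\<^sub>E F \<and> bij_betw g W F}"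
      by (auto simp: bij_betw_def PiE_iff)
    then show "(\<Sum>g\<in>{g \<in> {g. g \<in> ?G \<and> inj_on g W}. g ` W = F}. ?h g)
        = det_on W (\<lambda>u v. s u (f F v)) * det_on W (\<lambda>u. t (f F u))"
      using sum_bijections_eq_product_of_minors[OF fin(1) bij, of F s t] subset by simp
  qed
  finally show ?thesis .
qed

definition sq_norm_minor :: "('v \<Rightarrow> 'e \<Rightarrow> complex) \<Rightarrow> 'v set \<Rightarrow> 'e set \<Rightarrow> real" where
  "sq_norm_minor s W F =
    (if card W = card F then (cmod (det_on W (\<lambda>u v. s u ((SOME f. bij_betw f W F) v))))\<^sup>2 else 0)"

lemma sq_norm_minor_eq:
  assumes fin: "finite W" and bij_f: "bij_betw f W F"
  shows "sq_norm_minor s W F = (cmod (det_on W (\<lambda>u v. s u (f v))))\<^sup>2"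
proof -
  define g where "g = (SOME g. bij_betw g W F)"
  have bij_g: "bij_betw g W F"
    unfolding g_def by (rule someI[where P = "\<lambda>g. bij_betw g W F", OF bij_f])
  obtain q where perm: "q permutes W" "\<And>v. v \<in> W \<Longrightarrow> g v = f (q v)"
    using bijections_differ_by_permutation[OF bij_f bij_g] by blast
  then have "det_on W (\<lambda>u v. s u (g v)) = of_int (sign q) * det_on W (\<lambda>u v. s u (f v))"
    using det_on_permute_columns[OF fin perm(1), of "\<lambda>u v. s u (f v)"] by (simp cong: det_on_cong)
  then have "cmod (det_on W (\<lambda>u v. s u (g v))) = cmod (det_on W (\<lambda>u v. s u (f v)))"
    by (simp add: norm_mult sign_def)
  then show ?thesis
    using bij_betw_same_card[OF bij_f] by (simp add: sq_norm_minor_def g_def)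
qed

corollary det_on_Gram_eq_sum_sq_norm_minors:
  fixes s :: "'v \<Rightarrow> 'e \<Rightarrow> complex"
  assumes fin: "finite W" "finite E"
  shows "det_on W (\<lambda>u v. \<Sum>e\<in>E. s u e * cnj (s v e))
    = (\<Sum>F | F \<subseteq> E \<and> card F = card W. complex_of_real (sq_norm_minor s W F))"
proof -
  define f :: "'e set \<Rightarrow> 'v \<Rightarrow> 'e" where "f F = (SOME f. bij_betw f W F)" for F
  have bij: "bij_betw (f F) W F" if "F \<subseteq> E" "card F = card W" for F
    using finite_same_card_bij[OF fin(1) finite_subset[OF that(1) fin(2)]] that(2)
    unfolding f_def by (metis someI_ex)
  have minors: "det_on W (\<lambda>u v. s u (f F v)) * det_on W (\<lambda>u v. cnj (s v (f F u)))
      = complex_of_real (sq_norm_minor s W F)" if subset: "F \<subseteq> E" "card F = card W" for F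
  proof -
    have "det_on W (\<lambda>u v. cnj (s v (f F u))) = cnj (det_on W (\<lambda>u v. s u (f F v)))"
      unfolding det_on_transpose[OF fin(1), of "\<lambda>u v. cnj (s u (f F v))"] by (simp add: det_on_def)
    then show ?thesis by (simp only: sq_norm_minor_eq[OF fin(1) bij[OF subset]] complex_norm_square)
  qed
  have "det_on W (\<lambda>u v. \<Sum>e\<in>E. s u e * cnj (s v e)) = (\<Sum>F | F \<subseteq> E \<and> card F = card W.
      det_on W (\<lambda>u v. s u (f F v)) * det_on W (\<lambda>u v. cnj (s v (f F u))))"
    by (rule det_on_Cauchy_Binet[OF fin bij])
  also have "\<dots> = (\<Sum>F | F \<subseteq> E \<and> card F = card W. complex_of_real (sq_norm_minor s W F))"
    by (intro sum.cong refl) (simp add: minors)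
  finally show ?thesis .
qed

lemma sq_norm_minor_block_triangular:
  assumes fin: "finite W1" "finite W2" "finite F1" "finite F2"
    and disj: "W1 \<inter> W2 = {}" "F1 \<inter> F2 = {}" and square: "card W1 = card F1"
    and zero: "\<And>v e. v \<in> W2 \<Longrightarrow> e \<in> F1 \<Longrightarrow> s v e = 0"
  shows "sq_norm_minor s (W1 \<union> W2) (F1 \<union> F2) = sq_norm_minor s W1 F1 * sq_norm_minor s W2 F2"
proof (cases "card W2 = card F2")
  case False
  then show ?thesis using square fin disj by (simp add: sq_norm_minor_def card_Un_disjoint)
next
  case True
  obtain f1 f2 where bij_f1: "bij_betw f1 W1 F1" and bij_f2: "bij_betw f2 W2 F2"
    using finite_same_card_bij[OF fin(1,3) square] finite_same_card_bij[OF fin(2,4) True] by blast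
  define f where "f v = (if v \<in> W1 then f1 v else f2 v)" for v
  have bij1: "bij_betw f W1 F1"
    using bij_f1 by (rule iffD1[OF bij_betw_cong, rotated]) (simp add: f_def)
  have bij2: "bij_betw f W2 F2"
    using bij_f2 by (rule iffD1[OF bij_betw_cong, rotated]) (use disj in \<open>auto simp: f_def\<close>)
  have "det_on (W1 \<union> W2) (\<lambda>u v. s u (f v))
      = det_on W1 (\<lambda>u v. s u (f v)) * det_on W2 (\<lambda>u v. s u (f v))"
    using fin disj zero bij_betwE[OF bij1] by (intro det_on_block_triangular) auto
  then show ?thesis
    using fin bij1 bij2 bij_betw_combine[OF bij1 bij2 disj(2)]
    by (simp add: sq_norm_minor_eq norm_mult power_mult_distrib)
qed

lemma sq_norm_minor_eq_0_if_zero_block: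
  assumes fin: "finite W" "finite F" and sub: "R \<subseteq> W" "H \<subseteq> F"
    and large: "card F < card R + card H"
    and zero: "\<And>v e. v \<in> R \<Longrightarrow> e \<in> H \<Longrightarrow> s v e = 0"
  shows "sq_norm_minor s W F = 0"
proof (cases "card W = card F")
  case True
  then obtain f where bij: "bij_betw f W F" using finite_same_card_bij[OF fin] by metis
  define C where "C = {v \<in> W. f v \<in> H}"
  have "f ` C = H" using bij sub(2) by (auto simp: C_def bij_betw_def)
  moreover have "inj_on f C" using bij by (auto simp: C_def bij_betw_def inj_on_def)
  ultimately have "card C = card H" by (metis card_image)
  then have "card W < card R + card C" using True large by simp
  then have "det_on W (\<lambda>u v. s u (f v)) = 0"
    using zero by (intro det_on_eq_0_if_zero_block[OF fin(1) sub(1), of C]) (auto simp: C_def)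
  then show ?thesis by (simp add: sq_norm_minor_eq[OF fin(1) bij])
qed (simp add: sq_norm_minor_def)

lemma sq_norm_minor_Un:
  assumes fin: "finite W1" "finite W2" "finite F1" "finite F2"
    and disj: "W1 \<inter> W2 = {}" "F1 \<inter> F2 = {}"
    and zero: "\<And>v e. v \<in> W1 \<Longrightarrow> e \<in> F2 \<Longrightarrow> s v e = 0" "\<And>v e. v \<in> W2 \<Longrightarrow> e \<in> F1 \<Longrightarrow> s v e = 0"
  shows "sq_norm_minor s (W1 \<union> W2) (F1 \<union> F2) = sq_norm_minor s W1 F1 * sq_norm_minor s W2 F2"
proof (cases "card W1 = card F1")
  case True
  then show ?thesis using fin disj zero(2) by (intro sq_norm_minor_block_triangular)
next
  case False
  have card: "card (W1 \<union> W2) = card W1 + card W2" "card (F1 \<union> F2) = card F1 + card F2"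
    using fin disj by (simp_all add: card_Un_disjoint)
  consider (not_square) "card (W1 \<union> W2) \<noteq> card (F1 \<union> F2)"
    | (tall) "card F1 < card W1" | (wide) "card F2 < card W2"
    using False card by linarith
  then have "sq_norm_minor s (W1 \<union> W2) (F1 \<union> F2) = 0"
  proof cases
    case tall
    then show ?thesis
      using fin zero(1) card(2) by (intro sq_norm_minor_eq_0_if_zero_block[of _ _ W1 F2]) auto
  next
    case wide
    then show ?thesis
      using fin zero(2) card(2) by (intro sq_norm_minor_eq_0_if_zero_block[of _ _ W2 F1]) auto
  qed (simp add: sq_norm_minor_def)
  then show ?thesis using False by (simp add: sq_norm_minor_def)
qed

lemma sq_norm_minor_empty [simp]: "sq_norm_minor s {} {} = 1"
  using sq_norm_minor_eq[of "{}" undefined "{}" s] by (simp add: bij_betw_def det_on_def)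

lemma sq_norm_minor_Union:
  assumes "finite \<K>" "\<And>W F. (W, F) \<in> \<K> \<Longrightarrow> finite W \<and> finite F"
    and "\<And>W F W' F'. (W, F) \<in> \<K> \<Longrightarrow> (W', F') \<in> \<K> \<Longrightarrow> (W, F) \<noteq> (W', F') \<Longrightarrow>
      W \<inter> W' = {} \<and> F \<inter> F' = {} \<and> (\<forall>v\<in>W. \<forall>e\<in>F'. s v e = 0)"
  shows "sq_norm_minor s (\<Union>(fst ` \<K>)) (\<Union>(snd ` \<K>)) = (\<Prod>(W, F)\<in>\<K>. sq_norm_minor s W F)"
  using assms
proof (induction \<K> rule: finite_induct)
  case (insert K \<K>)
  obtain W F where K_eq: "K = (W, F)" by force
  have separated: "W \<inter> W' = {} \<and> F \<inter> F' = {} \<and> (\<forall>v\<in>W. \<forall>e\<in>F'. s v e = 0) \<and> (\<forall>v\<in>W'. \<forall>e\<in>F. s v e = 0)"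
    if "(W', F') \<in> \<K>" for W' F'
  proof -
    have "(W, F) \<noteq> (W', F')" using that insert.hyps K_eq by blast
    then show ?thesis
      using insert.prems(2)[of W F W' F'] insert.prems(2)[of W' F' W F] that K_eq by auto
  qed
  have "sq_norm_minor s (W \<union> \<Union>(fst ` \<K>)) (F \<union> \<Union>(snd ` \<K>))
      = sq_norm_minor s W F * sq_norm_minor s (\<Union>(fst ` \<K>)) (\<Union>(snd ` \<K>))"
  proof (rule sq_norm_minor_Un)
    show "finite W" "finite F" using insert.prems(1)[of W F] K_eq by auto
    show "finite (\<Union>(fst ` \<K>))" "finite (\<Union>(snd ` \<K>))"
      using insert.prems(1) insert.hyps by fastforce+
    show "W \<inter> \<Union>(fst ` \<K>) = {}" "F \<inter> \<Union>(snd ` \<K>) = {}" using separated by fastforce+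
    show "s v e = 0" if "v \<in> W" "e \<in> \<Union>(snd ` \<K>)" for v e using separated that by force
    show "s v e = 0" if "v \<in> \<Union>(fst ` \<K>)" "e \<in> F" for v e using separated that by force
  qed
  also have "sq_norm_minor s (\<Union>(fst ` \<K>)) (\<Union>(snd ` \<K>)) = (\<Prod>(W, F)\<in>\<K>. sq_norm_minor s W F)"
    by (intro insert.IH insert.prems) auto
  finally show ?case using insert.hyps K_eq by simp
qed simp

section \<open>Connected graphs and cycles\<close>

abbreviation adj :: "'v set set \<Rightarrow> 'v rel" where
  "adj F \<equiv> {(x, y). {x, y} \<in> F}"

abbreviation inner_edges :: "'v set \<Rightarrow> 'v set set \<Rightarrow> 'v set set" where
  "inner_edges W F \<equiv> {e \<in> F. e \<subseteq> W}"

lemma adj_rtrancl_sym: "(u, v) \<in> (adj F)\<^sup>* \<Longrightarrow> (v, u) \<in> (adj F)\<^sup>*"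
  by (rule symD[OF sym_rtrancl]) (auto simp: sym_def insert_commute)

lemma traversal_edges_conv: "traversal_edges cs = (\<lambda>i. {cs ! i, cyc_succ cs i}) ` {..<length cs}"
  by (auto simp: traversal_edges_def)

lemma traversal_edges_subset: "cycle_traversal F cs \<Longrightarrow> traversal_edges cs \<subseteq> F"
  by (auto simp: cycle_traversal_def traversal_edges_def)

lemma cycle_nonempty: "C \<in> cycles F \<Longrightarrow> C \<noteq> {}"
  by (auto simp: cycles_def cycle_traversal_def traversal_edges_conv lessThan_empty_iff)

lemma cycle_traversal_mono: "cycle_traversal F cs \<Longrightarrow> F \<subseteq> F' \<Longrightarrow> cycle_traversal F' cs"
  by (auto simp: cycle_traversal_def)

lemma cycles_Diff: "cycles (F - {e}) = {C \<in> cycles F. e \<notin> C}"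
  by (auto simp: cycles_def cycle_traversal_def traversal_edges_def)

lemma inj_on_traversal_edge:
  assumes "3 \<le> length cs" "distinct cs"
  shows "inj_on (\<lambda>i. {cs ! i, cyc_succ cs i}) {..<length cs}"
proof (rule inj_onI, rule ccontr)
  fix i j
  assume indices: "i \<in> {..<length cs}" "j \<in> {..<length cs}"
    and eq: "{cs ! i, cyc_succ cs i} = {cs ! j, cyc_succ cs j}" and "i \<noteq> j"
  then have "cs ! i \<noteq> cs ! j" using assms(2) by (simp add: nth_eq_iff_index_eq)
  then have "cyc_succ cs i = cs ! j" "cyc_succ cs j = cs ! i"
    using eq by (auto simp: doubleton_eq_iff)
  moreover have "Suc i mod length cs < length cs" "Suc j mod length cs < length cs"
    using assms(1) by (auto intro: mod_less_divisor)
  ultimately have "Suc i mod length cs = j" "Suc j mod length cs = i"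
    using indices assms(2) by (auto simp: cyc_succ_def nth_eq_iff_index_eq)
  then show False using indices assms(1) by (auto simp: mod_Suc split: if_splits)
qed

lemma cycle_traversal_detour:
  assumes cyc: "cycle_traversal F cs" and i_less: "i < length cs"
  shows "(cyc_succ cs i, cs ! i) \<in> (adj (F - {{cs ! i, cyc_succ cs i}}))\<^sup>*"
proof -
  let ?n = "length cs" and ?R = "adj (F - {{cs ! i, cyc_succ cs i}})"
  have simple: "3 \<le> ?n" "distinct cs" using cyc by (auto simp: cycle_traversal_def)
  have step: "(cs ! ((i + m) mod ?n), cs ! ((i + Suc m) mod ?n)) \<in> ?R" if m_bounds: "0 < m" "m < ?n"
    for m
  proof -
    define j where "j = (i + m) mod ?n"
    have j_less: "j < ?n" unfolding j_def using simple by (intro mod_less_divisor) auto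
    have "j = (if i + m < ?n then i + m else i + m - ?n)"
      unfolding j_def using i_less m_bounds by (simp add: le_mod_geq)
    then have "j \<noteq> i" using m_bounds by (simp split: if_splits)
    then have "{cs ! j, cyc_succ cs j} \<noteq> {cs ! i, cyc_succ cs i}"
      using inj_onD[OF inj_on_traversal_edge[OF simple], of j i] i_less j_less by auto
    then have "(cs ! j, cyc_succ cs j) \<in> ?R"
      using cyc j_less by (auto simp: cycle_traversal_def)
    moreover have "cyc_succ cs j = cs ! ((i + Suc m) mod ?n)"
      unfolding cyc_succ_def j_def by (simp add: mod_Suc_eq)
    ultimately show ?thesis by (simp add: j_def)
  qed
  have walk: "(cyc_succ cs i, cs ! ((i + Suc m) mod ?n)) \<in> ?R\<^sup>*" if "m < ?n" for m
    using that
  proof (induction m)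
    case 0
    show ?case by (simp add: cyc_succ_def)
  next
    case (Suc m)
    then show ?case using step[of "Suc m"] by (simp add: rtrancl_into_rtrancl)
  qed
  have "i + Suc (?n - 1) = i + ?n" using i_less by linarith
  with walk[of "?n - 1"] show ?thesis using i_less by simp
qed

lemma connected_graph_remove_cycle_edge:
  assumes conn: "connected_graph W F" and cyc: "cycle_traversal F cs"
    and on_cycle: "e \<in> traversal_edges cs"
  shows "connected_graph W (F - {e})"
proof -
  obtain i where e_eq: "i < length cs" "e = {cs ! i, cyc_succ cs i}"
    using on_cycle by (auto simp: traversal_edges_def)
  note detour = cycle_traversal_detour[OF cyc e_eq(1), folded e_eq(2)]
  have "adj F \<subseteq> (adj (F - {e}))\<^sup>*"
    using detour adj_rtrancl_sym[OF detour] e_eq(2) by (auto simp: doubleton_eq_iff)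
  then have "(adj F)\<^sup>* \<subseteq> (adj (F - {e}))\<^sup>*" by (rule rtrancl_subset_rtrancl)
  then show ?thesis using conn by (auto simp: connected_graph_def)
qed

lemma rtrancl_adj_imp_simple_path:
  assumes "(u, v) \<in> (adj F)\<^sup>*"
  obtains xs where "xs \<noteq> []" "hd xs = u" "last xs = v" "distinct xs"
    "successively (\<lambda>x y. {x, y} \<in> F) xs"
proof -
  have "\<exists>xs. xs \<noteq> [] \<and> hd xs = u \<and> last xs = v \<and> distinct xs \<and> successively (\<lambda>x y. {x, y} \<in> F) xs"
    using assms
  proof (induction rule: rtrancl_induct)
    case base
    show ?case by (rule exI[of _ "[u]"]) auto
  next
    case (step y z)
    then obtain xs where path: "xs \<noteq> []" "hd xs = u" "last xs = y" "distinct xs"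
      "successively (\<lambda>x y. {x, y} \<in> F) xs" by blast
    show ?case
    proof (cases "z \<in> set xs")
      case True
      then obtain ys zs where "xs = ys @ z # zs" by (meson split_list)
      then show ?thesis using path
        by (intro exI[of _ "ys @ [z]"]) (auto simp: successively_append_iff hd_append)
    next
      case False
      then show ?thesis using path step.hyps(2)
        by (intro exI[of _ "xs @ [z]"]) (auto simp: successively_append_iff)
    qed
  qed
  then show thesis using that by blast
qed

lemma cycle_through_edge:
  assumes path: "(u, v) \<in> (adj F)\<^sup>*" and non_adjacent: "u \<noteq> v" "{u, v} \<notin> F"
  shows "\<exists>cs. cycle_traversal (insert {u, v} F) cs"
proof -
  obtain xs where simple: "xs \<noteq> []" "hd xs = u" "last xs = v" "distinct xs"
    and steps: "successively (\<lambda>x y. {x, y} \<in> F) xs"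
    by (rule rtrancl_adj_imp_simple_path[OF path])
  have ends: "xs ! 0 = u" "xs ! (length xs - 1) = v"
    using simple by (auto simp: hd_conv_nth last_conv_nth)
  have edge: "{xs ! i, xs ! Suc i} \<in> F" if "Suc i < length xs" for i
    using steps that by (auto simp: successively_conv_nth)
  have "length xs \<noteq> 1" using ends non_adjacent(1) by auto
  moreover have "length xs \<noteq> 2" using ends edge[of 0] non_adjacent(2) by auto
  ultimately have "3 \<le> length xs" using simple(1) by (cases "length xs") auto
  moreover have "{xs ! i, cyc_succ xs i} \<in> insert {u, v} F" if "i < length xs" for i
  proof (cases "Suc i = length xs")
    case True
    then have "i = length xs - 1" by simp
    then show ?thesis using True ends by (simp add: cyc_succ_def insert_commute)
  next
    case False
    then show ?thesis using that edge by (simp add: cyc_succ_def)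
  qed
  ultimately show ?thesis using simple(4) by (auto simp: cycle_traversal_def)
qed

definition parent_map :: "'v set set \<Rightarrow> 'v set \<Rightarrow> ('v \<Rightarrow> nat) \<Rightarrow> ('v \<Rightarrow> 'v) \<Rightarrow> bool" where
  "parent_map F U d par \<longleftrightarrow> (\<forall>v\<in>U. {v, par v} \<in> F \<and> d (par v) < d v)"

lemma connected_graph_parent_map:
  assumes conn: "connected_graph W F" and roots: "R \<subseteq> W" "R \<noteq> {}"
  obtains d par where "parent_map F (W - R) d par"
proof -
  define d where "d v = (LEAST n. \<exists>r\<in>R. (v, r) \<in> adj F ^^ n)" for v
  have "\<exists>u. {v, u} \<in> F \<and> d u < d v" if not_root: "v \<in> W - R" for v
  proof -
    obtain r where "r \<in> R" using roots(2) by blast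
    then have "(v, r) \<in> (adj F)\<^sup>*" using conn not_root roots(1) by (auto simp: connected_graph_def)
    then have "\<exists>n. \<exists>r\<in>R. (v, r) \<in> adj F ^^ n" using \<open>r \<in> R\<close> rtrancl_imp_relpow by blast
    then have "\<exists>r\<in>R. (v, r) \<in> adj F ^^ d v" unfolding d_def by (rule LeastI_ex)
    then obtain r where nearest_root: "r \<in> R" "(v, r) \<in> adj F ^^ d v" by blast
    then obtain m where d_eq: "d v = Suc m" using not_root by (cases "d v") auto
    obtain u where first_step: "(v, u) \<in> adj F" "(u, r) \<in> adj F ^^ m"
      using relpow_Suc_D2 nearest_root(2) unfolding d_eq by metis
    have "d u \<le> m" unfolding d_def using first_step(2) nearest_root(1) by (intro Least_le) blast
    then show ?thesis using first_step(1) d_eq by auto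
  qed
  then show thesis using that unfolding parent_map_def by metis
qed

lemma parent_map_inj_on:
  assumes "parent_map F U d par"
  shows "inj_on (\<lambda>v. {v, par v}) U"
proof (rule inj_onI, rule ccontr)
  fix v w assume same_edge: "v \<in> U" "w \<in> U" "{v, par v} = {w, par w}" "v \<noteq> w"
  then have "par v = w" "par w = v" by (auto simp: doubleton_eq_iff)
  then show False using assms same_edge(1,2) unfolding parent_map_def by (metis less_asym)
qed

locale finite_graph =
  fixes W :: "'v set" and F :: "'v set set"
  assumes finite_vertices: "finite W"
    and edge: "e \<in> F \<Longrightarrow> e \<subseteq> W \<and> card e = 2"
begin

lemma finite_edges: "finite F"
  using edge finite_vertices by (intro finite_subset[of F "Pow W"]) auto

lemma finite_graph_subset: "F' \<subseteq> F \<Longrightarrow> finite_graph W F'"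
  using finite_vertices edge by unfold_locales auto

lemma card_remove_edge: "e \<in> F \<Longrightarrow> card F = Suc (card (F - {e}))"
  using finite_edges by (metis card_Suc_Diff1)

lemma parent_map_imp_connected:
  assumes par: "parent_map F (W - {r}) d par" and root: "r \<in> W"
  shows "connected_graph W F"
proof -
  have reach: "(v, r) \<in> (adj F)\<^sup>*" if "v \<in> W" for v
    using that
  proof (induction "d v" arbitrary: v rule: less_induct)
    case less
    show ?case
    proof (cases "v = r")
      case False
      then have "{v, par v} \<in> F" "d (par v) < d v"
        using par less.prems by (auto simp: parent_map_def)
      moreover from this have "(par v, r) \<in> (adj F)\<^sup>*" using edge less.hyps by blast
      ultimately show ?thesis by (intro converse_rtrancl_into_rtrancl[of v "par v"]) simp_all
    qed simp
  qed
  have "(u, v) \<in> (adj F)\<^sup>*" if "u \<in> W" "v \<in> W" for u v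
    using reach[OF that(1)] adj_rtrancl_sym[OF reach[OF that(2)]] by (rule rtrancl_trans)
  then show ?thesis using root by (auto simp: connected_graph_def)
qed

lemma connected_graph_rooted:
  assumes "connected_graph W F"
  obtains r d par where "r \<in> W" "parent_map F (W - {r}) d par"
    "(\<lambda>v. {v, par v}) ` (W - {r}) \<subseteq> F" "card ((\<lambda>v. {v, par v}) ` (W - {r})) + 1 = card W"
proof -
  obtain r where root: "r \<in> W" using assms by (auto simp: connected_graph_def)
  obtain d par where par: "parent_map F (W - {r}) d par"
    using connected_graph_parent_map[OF assms, of "{r}"] root by auto
  have "card ((\<lambda>v. {v, par v}) ` (W - {r})) + 1 = card W"
    using card_image[OF parent_map_inj_on[OF par]] card_Suc_Diff1[OF finite_vertices root] by simp
  then show thesis using that[OF root par] par by (auto simp: parent_map_def)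
qed

lemma connected_card_le:
  assumes "connected_graph W F"
  shows "card W \<le> card F + 1"
  using connected_graph_rooted[OF assms] card_mono[OF finite_edges] by (metis add_le_mono1)

lemma connected_remove_edge_imp_cycle:
  assumes e_in: "e \<in> F" and conn: "connected_graph W (F - {e})"
  shows "cycles F \<noteq> {}"
proof -
  obtain u v where e_eq: "e = {u, v}" "u \<noteq> v" using edge[OF e_in] by (auto simp: card_2_iff)
  then have "(u, v) \<in> (adj (F - {e}))\<^sup>*"
    using conn edge[OF e_in] by (auto simp: connected_graph_def)
  then obtain cs where "cycle_traversal (insert e (F - {e})) cs"
    using cycle_through_edge[of u v "F - {e}"] e_eq by auto
  then show ?thesis using e_in by (auto simp: cycles_def insert_absorb)
qed

lemma acyclic_iff_card:
  assumes conn: "connected_graph W F"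
  shows "cycles F = {} \<longleftrightarrow> card W = card F + 1"
proof
  assume acyclic: "cycles F = {}"
  obtain r d par where root: "r \<in> W" and par: "parent_map F (W - {r}) d par"
    and tree_edges: "(\<lambda>v. {v, par v}) ` (W - {r}) \<subseteq> F"
      "card ((\<lambda>v. {v, par v}) ` (W - {r})) + 1 = card W"
    by (rule connected_graph_rooted[OF conn])
  let ?T = "(\<lambda>v. {v, par v}) ` (W - {r})"
  have "e \<in> ?T" if "e \<in> F" for e
  proof (rule ccontr)
    assume "e \<notin> ?T"
    then have "parent_map (F - {e}) (W - {r}) d par" using par by (auto simp: parent_map_def)
    then have "connected_graph W (F - {e})"
      using finite_graph.parent_map_imp_connected[OF finite_graph_subset] root by blast
    then show False using connected_remove_edge_imp_cycle[OF that] acyclic by blast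
  qed
  then have "?T = F" using tree_edges(1) by blast
  then show "card W = card F + 1" using tree_edges(2) by simp
next
  assume card: "card W = card F + 1"
  show "cycles F = {}"
  proof (rule ccontr)
    assume "cycles F \<noteq> {}"
    then obtain C e where "C \<in> cycles F" "e \<in> C" using cycle_nonempty by blast
    then obtain cs where cyc: "cycle_traversal F cs" "e \<in> traversal_edges cs"
      by (auto simp: cycles_def)
    have "card W \<le> card (F - {e}) + 1"
      using connected_graph_remove_cycle_edge[OF conn cyc] finite_graph_subset
      by (intro finite_graph.connected_card_le) auto
    moreover have "e \<in> F" using traversal_edges_subset[OF cyc(1)] cyc(2) by blast
    ultimately show False using card card_remove_edge[of e] by linarith
  qed
qed

lemma cycle_edge_acyclic_iff_card:
  assumes conn: "connected_graph W F" and cyc: "C \<in> cycles F" "e \<in> C"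
  shows "cycles (F - {e}) = {} \<longleftrightarrow> card W = card F"
proof -
  obtain cs where traversal: "cycle_traversal F cs" "C = traversal_edges cs"
    using cyc(1) by (auto simp: cycles_def)
  then have "connected_graph W (F - {e})"
    using connected_graph_remove_cycle_edge[OF conn] cyc(2) by blast
  then have "cycles (F - {e}) = {} \<longleftrightarrow> card W = card (F - {e}) + 1"
    by (intro finite_graph.acyclic_iff_card finite_graph_subset) auto
  moreover have "e \<in> F" using traversal_edges_subset[OF traversal(1)] traversal(2) cyc(2) by blast
  ultimately show ?thesis using card_remove_edge[of e] by linarith
qed

lemma unicyclic_iff_card:
  assumes conn: "connected_graph W F"
  shows "(\<exists>!C. C \<in> cycles F) \<longleftrightarrow> card W = card F"
proof
  assume "\<exists>!C. C \<in> cycles F"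
  then obtain C where unique: "C \<in> cycles F" "\<And>C'. C' \<in> cycles F \<Longrightarrow> C' = C" by blast
  obtain e where e_in: "e \<in> C" using cycle_nonempty[OF unique(1)] by blast
  then have "cycles (F - {e}) = {}" using unique(2) by (auto simp: cycles_Diff)
  then show "card W = card F" using cycle_edge_acyclic_iff_card[OF conn unique(1) e_in] by simp
next
  assume card: "card W = card F"
  have "C \<subseteq> C'" if "C \<in> cycles F" "C' \<in> cycles F" for C C'
    using cycle_edge_acyclic_iff_card[OF conn that(1)] card that(2) by (auto simp: cycles_Diff)
  moreover have "cycles F \<noteq> {}" using acyclic_iff_card[OF conn] card by simp
  ultimately show "\<exists>!C. C \<in> cycles F" by blast
qed

end

section \<open>Minors of connected substructures\<close>

locale finite_substructure =
  fixes W :: "'v set" and F :: "'v set set"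
  assumes finite_vertices: "finite W" and finite_edges: "finite F"
    and edge: "e \<in> F \<Longrightarrow> card e = 2 \<and> e \<inter> W \<noteq> {}"
begin

sublocale inner: finite_graph W "inner_edges W F"
  using finite_vertices edge by unfold_locales auto

lemma pendant_iff:
  assumes "e \<in> F"
  shows "card (e \<inter> W) = 1 \<longleftrightarrow> \<not> e \<subseteq> W"
proof -
  have "finite e" using edge[OF assms] by (intro card_ge_0_finite) simp
  then have cards: "finite e" "card e = 2" "0 < card (e \<inter> W)"
    using edge[OF assms] by (simp_all add: card_gt_0_iff)
  show ?thesis
  proof (cases "e \<subseteq> W")
    case True
    then show ?thesis using cards(2) by (simp add: Int_absorb2)
  next
    case False
    then have "card (e \<inter> W) < 2" using psubset_card_mono[OF cards(1), of "e \<inter> W"] cards(2) by auto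
    then show ?thesis using False cards(3) by linarith
  qed
qed

lemma card_edges: "card F = card (inner_edges W F) + card {e \<in> F. card (e \<inter> W) = 1}"
proof -
  have "card F = card (inner_edges W F \<union> {e \<in> F. card (e \<inter> W) = 1})"
    using pendant_iff by (intro arg_cong[where f = card]) auto
  also have "\<dots> = card (inner_edges W F) + card {e \<in> F. card (e \<inter> W) = 1}"
    using finite_edges pendant_iff by (intro card_Un_disjoint) auto
  finally show ?thesis .
qed

lemma rootless_tree_iff:
  "rootless_tree (W, F) \<longleftrightarrow>
    connected_graph W (inner_edges W F) \<and> card W = card (inner_edges W F) + 1 \<and>
    card F = card (inner_edges W F) + 1"
proof -
  have "(\<exists>!e. e \<in> F \<and> card (e \<inter> W) = 1) \<longleftrightarrow> card {e \<in> F. card (e \<inter> W) = 1} = 1"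
    using is_singleton_iff_ex1[of "{e \<in> F. card (e \<inter> W) = 1}"] unfolding is_singleton_altdef by simp
  then show ?thesis
    using inner.acyclic_iff_card card_edges by (auto simp: rootless_tree_def tree_graph_def)
qed

lemma unicyclic_iff:
  "unicyclic (W, F) \<longleftrightarrow>
    connected_graph W (inner_edges W F) \<and> card W = card (inner_edges W F) \<and>
    card F = card (inner_edges W F)"
proof -
  have "inner_edges W F = F \<longleftrightarrow> card F = card (inner_edges W F)"
    using card_subset_eq[OF finite_edges] by (metis (no_types, lifting) mem_Collect_eq subsetI)
  moreover have "(\<forall>e\<in>F. e \<subseteq> W) \<longleftrightarrow> inner_edges W F = F"
    unfolding set_eq_iff by blast
  then have "unicyclic (W, F) \<longleftrightarrow>
      inner_edges W F = F \<and> connected_graph W (inner_edges W F) \<and>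
      (\<exists>!C. C \<in> cycles (inner_edges W F))"
    by (cases "inner_edges W F = F") (simp_all add: unicyclic_def)
  ultimately show ?thesis using inner.unicyclic_iff_card by blast
qed

lemma rootless_tree_not_unicyclic: "rootless_tree (W, F) \<Longrightarrow> \<not> unicyclic (W, F)"
  by (simp add: rootless_tree_iff unicyclic_iff)

lemma square_iff_rootless_tree_or_unicyclic:
  assumes "connected_graph W (inner_edges W F)"
  shows "card W = card F \<longleftrightarrow> rootless_tree (W, F) \<or> unicyclic (W, F)"
  using assms inner.connected_card_le[OF assms] card_edges
  unfolding rootless_tree_iff unicyclic_iff by linarith

end

definition traversal_gain :: "('v \<Rightarrow> 'v set \<Rightarrow> complex) \<Rightarrow> 'v list \<Rightarrow> complex" where
  "traversal_gain s cs = (\<Prod>i<length cs.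
    s (cs ! i) {cs ! i, cyc_succ cs i} * cnj (s (cyc_succ cs i) {cs ! i, cyc_succ cs i}))"

lemma cmod_add_unimodular:
  assumes unit: "cmod Q = 1" and pos: "0 < n"
  shows "cmod (P + (- 1) ^ (n - 1) * Q) = cmod (1 - (- 1) ^ n * (P * cnj Q))"
proof -
  have "Q * cnj Q = 1" using unit complex_norm_square[of Q] by simp
  moreover obtain m where "n = Suc m" using pos by (cases n) auto
  ultimately have "1 - (- 1) ^ n * (P * cnj Q)
      = (- 1) ^ (n - 1) * (P + (- 1) ^ (n - 1) * Q) * cnj Q"
    by (simp add: algebra_simps flip: power_add mult_2)
  then show ?thesis using unit by (simp add: norm_mult norm_power)
qed

locale unimodular_incidence =
  fixes s :: "'v \<Rightarrow> 'v set \<Rightarrow> complex"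
  assumes entry_eq_0: "v \<notin> e \<Longrightarrow> s v e = 0" and norm_entry: "v \<in> e \<Longrightarrow> cmod (s v e) = 1"
begin

lemma sq_norm_minor_parent_edges:
  assumes fin: "finite U" and par: "parent_map F U d par" and bij: "bij_betw (\<lambda>v. {v, par v}) U H"
  shows "sq_norm_minor s U H = 1"
proof -
  have "det_on U (\<lambda>u v. s u {v, par v}) = (\<Prod>v\<in>U. s v {v, par v})"
  proof (rule det_on_triangular[OF fin, of _ d])
    fix u v assume "u \<in> U" "v \<in> U" "u \<noteq> v" "s u {v, par v} \<noteq> 0"
    then show "d u < d v" using entry_eq_0[of u "{v, par v}"] par by (auto simp: parent_map_def)
  qed
  then show ?thesis
    by (simp add: sq_norm_minor_eq[OF fin bij] norm_entry flip: prod_norm)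
qed

text \<open>Ordered by distance to \<open>R\<close>, the vertices outside \<open>R\<close>, each paired with the first edge on its
  way to \<open>R\<close>, form a unitriangular block up to units.\<close>

lemma sq_norm_minor_prune_trees:
  assumes fin: "finite W" and conn: "connected_graph W (inner_edges W F)"
    and square: "card W = card F"
    and core: "R \<subseteq> W" "R \<noteq> {}" and core_edges: "H \<subseteq> F" "card H = card R" "\<And>e. e \<in> H \<Longrightarrow> e \<inter> W \<subseteq> R"
  shows "sq_norm_minor s W F = sq_norm_minor s R H"
proof -
  obtain d par where par: "parent_map (inner_edges W F) (W - R) d par"
    using connected_graph_parent_map[OF conn core] by blast
  have fin_core: "finite R" using fin core(1) by (rule rev_finite_subset)
  have "card W \<noteq> 0" using fin core by auto
  then have fin_edges: "finite F" using square by (metis card.infinite)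
  have "(\<lambda>v. {v, par v}) ` (W - R) \<subseteq> F - H"
    using par core_edges(3) by (fastforce simp: parent_map_def)
  moreover have "card (F - H) = card (W - R)"
    using square core(1) core_edges(1,2) fin fin_core fin_edges
    by (simp add: card_Diff_subset finite_subset)
  ultimately have "bij_betw (\<lambda>v. {v, par v}) (W - R) (F - H)"
    using parent_map_inj_on[OF par] fin_edges by (simp add: bij_betw_def card_image card_subset_eq)
  then have "sq_norm_minor s (W - R) (F - H) = 1"
    using fin by (intro sq_norm_minor_parent_edges[OF _ par]) auto
  moreover have "sq_norm_minor s (R \<union> (W - R)) (H \<union> (F - H))
      = sq_norm_minor s R H * sq_norm_minor s (W - R) (F - H)"
  proof (rule sq_norm_minor_block_triangular)
    show "s v e = 0" if "v \<in> W - R" "e \<in> H" for v e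
      using that core_edges(3) by (intro entry_eq_0) auto
  qed (use fin fin_core fin_edges core_edges finite_subset in auto)
  ultimately show ?thesis using core(1) core_edges(1) by (simp add: Un_absorb1)
qed

lemma sq_norm_minor_rootless_tree:
  assumes "finite_substructure W F" and tree: "rootless_tree (W, F)"
  shows "sq_norm_minor s W F = 1"
proof -
  interpret finite_substructure W F by fact
  have conn: "connected_graph W (inner_edges W F)" and square: "card W = card F"
    using tree by (simp_all add: rootless_tree_iff)
  obtain h where "h \<in> F" "card (h \<inter> W) = 1" using tree by (auto simp: rootless_tree_def)
  then obtain r where pendant: "h \<in> F" "h \<inter> W = {r}" by (auto simp: card_1_singleton_iff)
  then have "r \<in> h" by blast
  have "sq_norm_minor s W F = sq_norm_minor s {r} {h}"
    using pendant by (intro sq_norm_minor_prune_trees[OF finite_vertices conn square]) auto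
  also have "\<dots> = (cmod (det_on {r} (\<lambda>u v. s u h)))\<^sup>2"
    by (rule sq_norm_minor_eq) (auto simp: bij_betw_def)
  also have "det_on {r} (\<lambda>u v. s u h) = s r h"
    using det_on_triangular[of "{r}" "\<lambda>u v. s u h" "\<lambda>_. 0"] by simp
  also have "(cmod (s r h))\<^sup>2 = 1" using \<open>r \<in> h\<close> by (simp add: norm_entry)
  finally show ?thesis .
qed

lemma sq_norm_minor_cycle:
  assumes simple: "3 \<le> length cs" "distinct cs"
  shows "sq_norm_minor s (set cs) (traversal_edges cs)
    = (cmod (1 - (- 1) ^ length cs * traversal_gain s cs))\<^sup>2"
proof -
  let ?n = "length cs" and ?e = "\<lambda>i. {cs ! i, cyc_succ cs i}"
  define P where "P = (\<Prod>i<?n. s (cs ! i) (?e i))"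
  define Q where "Q = (\<Prod>i<?n. s (cyc_succ cs i) (?e i))"
  define f where "f = ?e \<circ> inv_into {..<?n} ((!) cs)"
  have nth: "bij_betw ((!) cs) {..<?n} (set cs)" by (rule bij_betw_nth[OF simple(2)]) simp_all
  have "bij_betw ?e {..<?n} (traversal_edges cs)"
    using inj_on_traversal_edge[OF simple] by (simp add: bij_betw_def traversal_edges_conv)
  then have bij: "bij_betw f (set cs) (traversal_edges cs)"
    unfolding f_def by (rule bij_betw_trans[OF bij_betw_inv_into[OF nth]])
  have f_nth: "f (cs ! j) = ?e j" if "j < ?n" for j
    using that by (simp add: f_def bij_betw_inv_into_left[OF nth])
  have "det_on (set cs) (\<lambda>u v. s u (f v))
      = (\<Prod>i<?n. s (cs ! i) (f (cs ! i)))
        + (- 1) ^ (?n - 1) * (\<Prod>i<?n. s (cyc_succ cs i) (f (cs ! i)))"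
  proof (rule det_on_cyclic_bidiagonal[OF simple(2)])
    fix i j assume indices: "i < ?n" "j < ?n" "i \<noteq> j" "i \<noteq> Suc j mod ?n"
    then have "Suc j mod ?n < ?n" by (intro mod_less_divisor) linarith
    then have "cs ! i \<notin> ?e j"
      using indices simple(2) by (simp add: cyc_succ_def nth_eq_iff_index_eq)
    then show "s (cs ! i) (f (cs ! j)) = 0" using indices(2) by (simp add: f_nth entry_eq_0)
  qed (use simple(1) in simp)
  then have "sq_norm_minor s (set cs) (traversal_edges cs) = (cmod (P + (- 1) ^ (?n - 1) * Q))\<^sup>2"
    by (simp add: sq_norm_minor_eq[OF _ bij] f_nth P_def Q_def)
  moreover have "cmod Q = 1" by (simp add: Q_def norm_entry flip: prod_norm)
  then have "cmod (P + (- 1) ^ (?n - 1) * Q) = cmod (1 - (- 1) ^ ?n * (P * cnj Q))"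
    by (rule cmod_add_unimodular) (use simple(1) in linarith)
  ultimately show ?thesis by (simp add: P_def Q_def traversal_gain_def prod.distrib)
qed

lemma sq_norm_minor_unicyclic:
  assumes "finite_substructure W F" and uni: "unicyclic (W, F)" and cyc: "cycle_traversal F cs"
  shows "sq_norm_minor s W F = (cmod (1 - (- 1) ^ length cs * traversal_gain s cs))\<^sup>2"
proof -
  interpret finite_substructure W F by fact
  have conn: "connected_graph W (inner_edges W F)" and square: "card W = card F"
    using uni by (simp_all add: unicyclic_iff)
  have simple: "3 \<le> length cs" "distinct cs" using cyc by (auto simp: cycle_traversal_def)
  have edges: "traversal_edges cs \<subseteq> F" by (rule traversal_edges_subset[OF cyc])
  have "sq_norm_minor s W F = sq_norm_minor s (set cs) (traversal_edges cs)"
  proof (rule sq_norm_minor_prune_trees[OF finite_vertices conn square _ _ edges])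
    have "{cs ! i, cyc_succ cs i} \<in> F" if "i < length cs" for i
      using cyc that by (simp add: cycle_traversal_def)
    then show "set cs \<subseteq> W" using uni by (fastforce simp: unicyclic_def in_set_conv_nth)
    show "card (traversal_edges cs) = card (set cs)"
      using card_image[OF inj_on_traversal_edge[OF simple]] simple(2)
      by (simp add: traversal_edges_conv distinct_card)
    have "cyc_succ cs i \<in> set cs" if "i < length cs" for i
      unfolding cyc_succ_def using that by (intro nth_mem mod_less_divisor) linarith
    then show "e \<inter> W \<subseteq> set cs" if "e \<in> traversal_edges cs" for e
      using that by (auto simp: traversal_edges_def)
  qed (use simple in auto)
  then show ?thesis by (simp only: sq_norm_minor_cycle[OF simple])
qed

end

section \<open>Components of substructures\<close>

abbreviation linked :: "'v set \<Rightarrow> 'v set set \<Rightarrow> ('v + 'v set) rel" where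
  "linked W F \<equiv> (incidence W F \<union> (incidence W F)\<inverse>)\<^sup>*"

lemma linked_sym: "(x, y) \<in> linked W F \<Longrightarrow> (y, x) \<in> linked W F"
  by (metis converse_Un converse_converse sup_commute rtrancl_converseI)

lemma linked_in:
  assumes "(x, y) \<in> linked W F" "x \<in> W <+> F"
  shows "y \<in> W <+> F"
  using assms by (induction rule: rtrancl_induct) (auto simp: incidence_def)

lemma linked_vertex_edge:
  assumes "v \<in> W" "e \<in> F" "v \<in> e"
  shows "(x, Inl v) \<in> linked W F \<longleftrightarrow> (x, Inr e) \<in> linked W F"
proof -
  have "(Inl v, Inr e) \<in> linked W F" using assms by (auto simp: incidence_def)
  from this linked_sym[OF this] show ?thesis by (meson rtrancl_trans)
qed

lemma componentsE:
  assumes "(W', F') \<in> components W F"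
  obtains x where "x \<in> W <+> F" "W' = {v. (x, Inl v) \<in> linked W F}"
    "F' = {e. (x, Inr e) \<in> linked W F}"
proof -
  obtain c where eqclass: "c \<in> (W <+> F) // linked W F" "(W', F') = (Inl -` c, Inr -` c)"
    using assms by (auto simp: components_def)
  obtain x where "x \<in> W <+> F" "c = linked W F `` {x}" using eqclass(1) by (rule quotientE)
  then show thesis using eqclass(2) by (intro that[of x]) auto
qed

lemma componentsI:
  "x \<in> W <+> F \<Longrightarrow> ({v. (x, Inl v) \<in> linked W F}, {e. (x, Inr e) \<in> linked W F}) \<in> components W F"
  by (auto simp: components_def quotient_def vimage_def Image_def image_iff)

lemma component_subset: "(W', F') \<in> components W F \<Longrightarrow> W' \<subseteq> W \<and> F' \<subseteq> F"
  by (erule componentsE) (auto dest: linked_in)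

lemma component_nonempty:
  assumes "(W', F') \<in> components W F"
  shows "W' \<noteq> {} \<or> F' \<noteq> {}"
proof -
  obtain x where "W' = {v. (x, Inl v) \<in> linked W F}" "F' = {e. (x, Inr e) \<in> linked W F}"
    using componentsE[OF assms] by metis
  then show ?thesis by (cases x) auto
qed

lemma component_incident_iff:
  assumes "(W', F') \<in> components W F" "v \<in> W" "e \<in> F" "v \<in> e"
  shows "v \<in> W' \<longleftrightarrow> e \<in> F'"
  using componentsE[OF assms(1)] linked_vertex_edge[OF assms(2-4)] by (metis mem_Collect_eq)

lemma component_linked:
  assumes "(W', F') \<in> components W F" "v \<in> W'"
  shows "u \<in> W' \<Longrightarrow> (Inl v, Inl u) \<in> linked W F" and "e \<in> F' \<Longrightarrow> (Inl v, Inr e) \<in> linked W F"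
  using componentsE[OF assms(1)] assms(2) linked_sym rtrancl_trans by (metis mem_Collect_eq)+

lemma Union_components: "\<Union>(fst ` components W F) = W" "\<Union>(snd ` components W F) = F"
proof -
  have "\<exists>K\<in>components W F. v \<in> fst K" if "v \<in> W" for v
    by (rule bexI[OF _ componentsI[of "Inl v"]]) (use that in auto)
  then show "\<Union>(fst ` components W F) = W" using component_subset[of _ _ W F] by fastforce
  have "\<exists>K\<in>components W F. e \<in> snd K" if "e \<in> F" for e
    by (rule bexI[OF _ componentsI[of "Inr e"]]) (use that in auto)
  then show "\<Union>(snd ` components W F) = F" using component_subset[of _ _ W F] by fastforce
qed

lemma finite_components: "finite W \<Longrightarrow> finite F \<Longrightarrow> finite (components W F)"
  by (rule finite_subset[of _ "Pow W \<times> Pow F"]) (use component_subset[of _ _ W F] in auto)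

lemma components_disjoint:
  assumes comps: "(W1, F1) \<in> components W F" "(W2, F2) \<in> components W F" "(W1, F1) \<noteq> (W2, F2)"
  shows "W1 \<inter> W2 = {}" "F1 \<inter> F2 = {}"
proof -
  obtain x where rep1: "W1 = {v. (x, Inl v) \<in> linked W F}" "F1 = {e. (x, Inr e) \<in> linked W F}"
    by (rule componentsE[OF comps(1)])
  obtain y where rep2: "W2 = {v. (y, Inl v) \<in> linked W F}" "F2 = {e. (y, Inr e) \<in> linked W F}"
    by (rule componentsE[OF comps(2)])
  have "\<not> ((x, z) \<in> linked W F \<and> (y, z) \<in> linked W F)" for z
  proof
    assume "(x, z) \<in> linked W F \<and> (y, z) \<in> linked W F"
    then have "(x, y) \<in> linked W F" "(y, x) \<in> linked W F"
      using linked_sym rtrancl_trans by metis+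
    then have "(x, w) \<in> linked W F \<longleftrightarrow> (y, w) \<in> linked W F" for w using rtrancl_trans by metis
    then show False using comps(3) rep1 rep2 by simp
  qed
  then show "W1 \<inter> W2 = {}" "F1 \<inter> F2 = {}" using rep1 rep2 by blast+
qed

lemma components_not_incident:
  assumes comps: "(W1, F1) \<in> components W F" "(W2, F2) \<in> components W F" "(W1, F1) \<noteq> (W2, F2)"
    and "v \<in> W1" "e \<in> F2"
  shows "v \<notin> e"
proof
  assume "v \<in> e"
  moreover have "v \<in> W" "e \<in> F" using assms component_subset by blast+
  ultimately have "v \<in> W2" using component_incident_iff[OF comps(2)] \<open>e \<in> F2\<close> by blast
  then show False using components_disjoint(1)[OF comps] \<open>v \<in> W1\<close> by blast
qed

lemma linked_imp_reachable:
  assumes edges: "\<And>e. e \<in> F \<Longrightarrow> card e = 2" and link: "(Inl u, z) \<in> linked W F" and u_in: "u \<in> W"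
  shows "\<exists>v. (u, v) \<in> (adj (inner_edges W F))\<^sup>* \<and> v \<in> W \<and>
    (z = Inl v \<or> (\<exists>e\<in>F. z = Inr e \<and> v \<in> e))"
  using link
proof (induction rule: rtrancl_induct)
  case base
  then show ?case using u_in by blast
next
  case (step y z)
  let ?R = "adj (inner_edges W F)"
  from step.IH obtain w where reached: "(u, w) \<in> ?R\<^sup>*" "w \<in> W"
    "y = Inl w \<or> (\<exists>e\<in>F. y = Inr e \<and> w \<in> e)"
    by blast
  from step.hyps(2) consider
      (out) v e where "y = Inl v" "z = Inr e" "e \<in> F" "v \<in> e"
    | (into) v e where "y = Inr e" "z = Inl v" "e \<in> F" "v \<in> e" "v \<in> W"
    by (auto simp: incidence_def)
  then show ?case
  proof cases
    case out
    then show ?thesis using reached by blast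
  next
    case into
    then have "w \<in> e" using reached(3) by auto
    have "v = w \<or> {w, v} = e"
      using \<open>w \<in> e\<close> into(3,4) edges[OF into(3)] by (auto simp: card_2_iff)
    then have "(u, v) \<in> ?R\<^sup>*"
      using reached(1,2) into(3,5) by (auto intro: rtrancl_into_rtrancl)
    then show ?thesis using into(2,5) by blast
  qed
qed

lemma reachable_in_component:
  assumes comp: "(W', F') \<in> components W F" and u_in: "u \<in> W'"
    and path: "(u, v) \<in> (adj (inner_edges W F))\<^sup>*"
  shows "v \<in> W' \<and> (u, v) \<in> (adj (inner_edges W' F'))\<^sup>*"
  using path
proof (induction rule: rtrancl_induct)
  case (step y z)
  then have "{y, z} \<in> F" "y \<in> W" "z \<in> W" "y \<in> W'" by auto
  then have "{y, z} \<in> F'" "z \<in> W'"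
    using component_incident_iff[OF comp, of y "{y, z}"]
      component_incident_iff[OF comp, of z "{y, z}"] by auto
  then show ?case using step.IH by (auto intro: rtrancl_into_rtrancl)
qed (use u_in in simp)

lemma component_connected_graph:
  assumes comp: "(W', F') \<in> components W F" and "W' \<noteq> {}" and edges: "\<And>e. e \<in> F \<Longrightarrow> card e = 2"
  shows "connected_graph W' (inner_edges W' F')"
proof -
  have "(u, v) \<in> (adj (inner_edges W' F'))\<^sup>*" if "u \<in> W'" "v \<in> W'" for u v
    using linked_imp_reachable[OF edges component_linked(1)[OF comp that]]
      component_subset[OF comp] that reachable_in_component[OF comp that(1)] by blast
  then show ?thesis using \<open>W' \<noteq> {}\<close> by (simp add: connected_graph_def)
qed

lemma component_finite_substructure:
  assumes comp: "(W', F') \<in> components W F" and "W' \<noteq> {}" and fin: "finite W" "finite F"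
    and edges: "\<And>e. e \<in> F \<Longrightarrow> card e = 2"
  shows "finite_substructure W' F'"
proof
  have sub: "W' \<subseteq> W" "F' \<subseteq> F" using component_subset[OF comp] by auto
  then show "finite W'" "finite F'" using fin finite_subset by auto
  fix e assume e_in: "e \<in> F'"
  obtain u where u_in: "u \<in> W'" using \<open>W' \<noteq> {}\<close> by blast
  then obtain v where "v \<in> W" "v \<in> e"
    using linked_imp_reachable[OF edges component_linked(2)[OF comp u_in e_in]] sub(1) by auto
  then have "v \<in> W'" using component_incident_iff[OF comp] sub(2) e_in by blast
  then show "card e = 2 \<and> e \<inter> W' \<noteq> {}" using edges sub(2) e_in \<open>v \<in> e\<close> by blast
qed

section \<open>The factorization of the matrix\<close>

lemma bij_betw_pick:
  assumes "finite I"
  shows "bij_betw (pick I) {0..<card I} I"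
proof (rule bij_betw_byWitness[where f' = "\<lambda>i. card {a \<in> I. a < i}"])
  have "card {a \<in> I. a < i} < card I" if "i \<in> I" for i
    using that by (intro psubset_card_mono[OF assms]) auto
  then show "(\<lambda>i. card {a \<in> I. a < i}) ` I \<subseteq> {0..<card I}" by auto
qed (auto simp: card_pick_le pick_card_in_set pick_in_set_le)

lemma det_principal_submatrix:
  assumes enum: "distinct vs" "W \<subseteq> set vs"
  shows "det (principal_submatrix vs (mat (length vs) (length vs) (\<lambda>(i, j). a (vs ! i) (vs ! j))) W)
    = det_on W a"
proof -
  let ?n = "length vs" and ?A = "mat (length vs) (length vs) (\<lambda>(i, j). a (vs ! i) (vs ! j))"
  define I where "I = {i. i < ?n \<and> vs ! i \<in> W}"
  have index_set: "finite I" "{i. i < ?n \<and> i \<in> I} = I" by (auto simp: I_def)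
  have "bij_betw ((!) vs) I W"
    using enum
    by (auto simp: bij_betw_def I_def inj_on_def nth_eq_iff_index_eq in_set_conv_nth subset_eq)
  with bij_betw_pick[OF index_set(1)] have bij: "bij_betw ((!) vs \<circ> pick I) {0..<card I} W"
    by (rule bij_betw_trans)
  have "pick I i < ?n" if "i < card I" for i
    using pick_in_set_le[OF that] by (simp add: I_def)
  then have "submatrix ?A I I = mat (card I) (card I) (\<lambda>(i, j). a (vs ! pick I i) (vs ! pick I j))"
    unfolding submatrix_def by (intro eq_matI) (simp_all add: index_set(2))
  then show ?thesis
    by (simp add: principal_submatrix_def det_on_eq_det[OF bij] flip: I_def)
qed

definition incidence_entry :: "('v \<times> 'v) set \<Rightarrow> 'v \<Rightarrow> 'v set \<Rightarrow> complex" where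
  "incidence_entry A v e = (if v \<notin> e then 0 else if \<exists>u. (v, u) \<in> A \<and> e = {v, u} then omega else 1)"

lemma omega_simps: "Re omega = 1 / 2" "Im omega = sqrt 3 / 2"
  by (simp_all add: omega_def)

lemma omega_nonzero: "omega \<noteq> 0"
  by (simp add: complex_eq_iff omega_simps)

lemma omega_mult_cnj: "omega * cnj omega = 1"
  by (simp add: complex_eq_iff omega_simps)

lemma cmod_omega: "cmod omega = 1"
  by (simp add: norm_complex_def omega_simps power_divide)

lemma cnj_omega: "cnj omega = inverse omega"
  using omega_mult_cnj by (metis inverse_unique)

context mixed_graph
begin

sublocale finite_graph V E
  using finite_verts edges_simple by unfold_locales

sublocale unimodular_incidence "incidence_entry A"
  by unfold_locales (auto simp: incidence_entry_def cmod_omega)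

lemma no_loops: "{v} \<notin> E" "(v, v) \<notin> A"
  using edge[of "{v}"] arcs_one_direction[of v v] by auto

lemma N_entry_eq_incidence_entry:
  assumes "{u, v} \<in> E"
  shows "N_entry E A u v = incidence_entry A u {u, v} * cnj (incidence_entry A v {u, v})"
proof -
  have "u \<noteq> v" using assms no_loops by auto
  then have "incidence_entry A u {u, v} = (if (u, v) \<in> A then omega else 1)"
    "incidence_entry A v {u, v} = (if (v, u) \<in> A then omega else 1)"
    by (auto simp: incidence_entry_def doubleton_eq_iff)
  then show ?thesis using assms arcs_one_direction[of u v] by (auto simp: N_entry_def)
qed

lemma Gram_entry:
  "(\<Sum>e\<in>E. incidence_entry A u e * cnj (incidence_entry A v e))
    = (if u = v then of_nat (degree_of E u) else 0) + N_entry E A u v"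
proof (cases "u = v")
  case True
  have "(\<Sum>e\<in>E. incidence_entry A u e * cnj (incidence_entry A u e)) = (\<Sum>e\<in>E. of_bool (u \<in> e))"
    by (intro sum.cong refl) (auto simp: incidence_entry_def omega_mult_cnj)
  also have "\<dots> = of_nat (degree_of E u)"
    using finite_edges by (simp add: degree_of_def sum_of_bool_eq Int_def)
  finally show ?thesis using True no_loops by (simp add: N_entry_def)
next
  case False
  have "incidence_entry A u e * cnj (incidence_entry A v e)
      = (if e = {u, v} then N_entry E A u v else 0)" if "e \<in> E" for e
  proof (cases "u \<in> e \<and> v \<in> e")
    case True
    then have "e = {u, v}" using edge[OF that] \<open>u \<noteq> v\<close> by (auto simp: card_2_iff)
    then show ?thesis using that N_entry_eq_incidence_entry by simp
  next
    case False
    then show ?thesis by (auto simp: entry_eq_0)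
  qed
  then have "(\<Sum>e\<in>E. incidence_entry A u e * cnj (incidence_entry A v e))
      = (if {u, v} \<in> E then N_entry E A u v else 0)"
    using finite_edges by simp
  moreover have "N_entry E A u v = 0" if "{u, v} \<notin> E"
    using that arcs_edges[of u v] arcs_edges[of v u] by (auto simp: N_entry_def insert_commute)
  ultimately show ?thesis using False by simp
qed

lemma Q_mat_eq_Gram:
  assumes "distinct vs"
  shows "Q_mat vs E A = mat (length vs) (length vs)
    (\<lambda>(i, j). \<Sum>e\<in>E. incidence_entry A (vs ! i) e * cnj (incidence_entry A (vs ! j) e))"
  unfolding Gram_entry
  by (intro eq_matI)
    (auto simp: Q_mat_def D_mat_def N_mat_def mat_diag_def nth_eq_iff_index_eq[OF assms])

theorem det_principal_submatrix_Q_mat: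
  assumes "distinct vs" "set vs = V" "V1 \<subseteq> V"
  shows "det (principal_submatrix vs (Q_mat vs E A) V1)
    = (\<Sum>E1 | E1 \<subseteq> E \<and> card E1 = card V1. complex_of_real (sq_norm_minor (incidence_entry A) V1 E1))"
proof -
  have "det (principal_submatrix vs (Q_mat vs E A) V1)
      = det_on V1 (\<lambda>u v. \<Sum>e\<in>E. incidence_entry A u e * cnj (incidence_entry A v e))"
    unfolding Q_mat_eq_Gram[OF assms(1)] using assms by (intro det_principal_submatrix) auto
  then show ?thesis
    using det_on_Gram_eq_sum_sq_norm_minors[OF finite_subset[OF assms(3) finite_verts] finite_edges]
    by simp
qed

end

section \<open>The contribution of a mixed cycle\<close>

lemma power_int_mod_period:
  fixes z :: "'a::field"
  assumes "z ^ n = 1" "0 < n"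
  shows "z powi k = z ^ nat (k mod int n)"
proof -
  have "z \<noteq> 0" using assms by (metis power_0_left zero_neq_one not_gr_zero)
  have "z powi k = z powi (int n * (k div int n) + k mod int n)" by simp
  also have "\<dots> = z powi (int n * (k div int n)) * z powi (k mod int n)"
    using \<open>z \<noteq> 0\<close> by (intro power_int_add) simp
  also have "z powi (int n * (k div int n)) = 1"
    using assms(1) by (simp add: power_int_mult)
  also have "z powi (k mod int n) = z ^ nat (k mod int n)"
    using assms(2) by (simp add: power_int_def)
  finally show ?thesis by simp
qed

lemma num_along_eq_sum: "num_along A cs = (\<Sum>i<length cs. of_bool ((cs ! i, cyc_succ cs i) \<in> A))"
  and num_against_eq_sum: "num_against A cs = (\<Sum>i<length cs. of_bool ((cyc_succ cs i, cs ! i) \<in> A))"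
  and num_undirected_eq_sum: "num_undirected A cs = (\<Sum>i<length cs.
      of_bool ((cs ! i, cyc_succ cs i) \<notin> A \<and> (cyc_succ cs i, cs ! i) \<notin> A))"
  by (simp_all add: num_along_def num_against_def num_undirected_def sum_of_bool_eq Int_def)

lemma Psi2_iff: "cs \<in> Psi2 A \<longleftrightarrow> \<not> 3 dvd flow A cs \<and> even (num_undirected A cs)"
  and Psi3_iff: "cs \<in> Psi3 A \<longleftrightarrow> 3 dvd flow A cs \<and> odd (num_undirected A cs)"
  and Psi4_iff: "cs \<in> Psi4 A \<longleftrightarrow> 3 dvd flow A cs \<and> even (num_undirected A cs)"
  unfolding Psi2_def Psi3_def Psi4_def mem_Collect_eq insert_iff empty_iff by presburger+

definition cycle_factor :: "('v \<times> 'v) set \<Rightarrow> 'v list \<Rightarrow> real" where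
  "cycle_factor A cs =
    (if cs \<in> Psi2 A then 3 else if cs \<in> Psi3 A then 4 else if cs \<in> Psi4 A then 0 else 1)"

lemma omega_power2: "omega\<^sup>2 = - cnj omega"
  by (simp add: complex_eq_iff power2_eq_square omega_simps)

lemma neg_omega_power3: "(- omega) ^ 3 = 1"
proof -
  have "(- omega) ^ 3 = - (omega * omega\<^sup>2)" by (simp add: power3_eq_cube power2_eq_square)
  then show ?thesis by (simp add: omega_power2 omega_mult_cnj)
qed

lemma sq_norm_one_minus_neg_omega_power:
  assumes "k \<in> {0, 1, 2}"
  shows "(cmod (1 - (- 1) ^ c * (- omega) ^ k))\<^sup>2
    = (if k = 0 then if even c then 0 else 4 else if even c then 3 else 1)"
proof -
  have "(cmod (1 + omega))\<^sup>2 = 3" "(cmod (1 - omega))\<^sup>2 = 1"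
    by (simp_all add: cmod_power2 omega_simps power_divide)
  moreover have "cmod (1 + cnj omega) = cmod (1 + omega)" "cmod (1 - cnj omega) = cmod (1 - omega)"
    using complex_mod_cnj[of "1 + omega"] complex_mod_cnj[of "1 - omega"] by simp_all
  ultimately show ?thesis
    using assms by (cases "even c") (auto simp: omega_power2)
qed

context mixed_graph
begin

lemma length_eq_num_along_against_undirected:
  "length cs = num_along A cs + num_against A cs + num_undirected A cs"
proof -
  have "(\<Sum>i<length cs. 1 :: nat) = (\<Sum>i<length cs. of_bool ((cs ! i, cyc_succ cs i) \<in> A)
      + of_bool ((cyc_succ cs i, cs ! i) \<in> A)
      + of_bool ((cs ! i, cyc_succ cs i) \<notin> A \<and> (cyc_succ cs i, cs ! i) \<notin> A))"
    by (intro sum.cong refl) (use arcs_one_direction in auto)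
  then show ?thesis
    by (simp only: sum.distrib sum_constant card_lessThan mult_1_right of_nat_id
        num_along_eq_sum num_against_eq_sum num_undirected_eq_sum)
qed

lemma traversal_gain_incidence_entry:
  assumes "cycle_traversal E cs"
  shows "traversal_gain (incidence_entry A) cs = omega powi flow A cs"
proof -
  have "traversal_gain (incidence_entry A) cs
      = (\<Prod>i<length cs. omega ^ of_bool ((cs ! i, cyc_succ cs i) \<in> A) *
          cnj omega ^ of_bool ((cyc_succ cs i, cs ! i) \<in> A))"
    unfolding traversal_gain_def
  proof (intro prod.cong refl)
    fix i assume "i \<in> {..<length cs}"
    then have in_E: "{cs ! i, cyc_succ cs i} \<in> E" using assms by (auto simp: cycle_traversal_def)
    show "incidence_entry A (cs ! i) {cs ! i, cyc_succ cs i} *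
        cnj (incidence_entry A (cyc_succ cs i) {cs ! i, cyc_succ cs i})
      = omega ^ of_bool ((cs ! i, cyc_succ cs i) \<in> A) *
        cnj omega ^ of_bool ((cyc_succ cs i, cs ! i) \<in> A)"
      unfolding N_entry_eq_incidence_entry[OF in_E, symmetric]
      using in_E arcs_one_direction by (auto simp: N_entry_def)
  qed
  also have "\<dots> = omega ^ num_along A cs * cnj omega ^ num_against A cs"
    by (simp add: prod.distrib num_along_eq_sum num_against_eq_sum flip: power_sum)
  also have "\<dots> = omega powi flow A cs"
    by (simp add: omega_nonzero flow_def cnj_omega power_int_diff power_inverse divide_inverse)
  finally show ?thesis .
qed

lemma sq_norm_one_minus_omega_power_flow:
  "(cmod (1 - (- 1) ^ length cs * omega powi flow A cs))\<^sup>2 = cycle_factor A cs"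
proof -
  let ?c = "num_undirected A cs" and ?k = "nat (flow A cs mod 3)"
  have "?k < 3" by (simp add: nat_less_iff)
  then have k_range: "?k \<in> {0, 1, 2}" by auto
  have k_eq_0: "?k = 0 \<longleftrightarrow> 3 dvd flow A cs"
    using pos_mod_sign[of 3 "flow A cs"] by (auto simp: dvd_eq_mod_eq_0)
  have "(- 1 :: complex) ^ length cs = (- 1) ^ ?c * (- 1) powi flow A cs"
    by (simp add: length_eq_num_along_against_undirected[of cs] flow_def power_int_diff power_add
        divide_inverse mult_ac flip: power_inverse)
  then have "(- 1) ^ length cs * omega powi flow A cs = (- 1) ^ ?c * (- omega) powi flow A cs"
    by (simp add: mult.assoc flip: power_int_mult_distrib)
  also have "(- omega) powi flow A cs = (- omega) ^ ?k"
    using power_int_mod_period[OF neg_omega_power3] by simp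
  finally have "(cmod (1 - (- 1) ^ length cs * omega powi flow A cs))\<^sup>2
      = (if ?k = 0 then if even ?c then 0 else 4 else if even ?c then 3 else 1)"
    using sq_norm_one_minus_neg_omega_power[of ?k ?c] k_range by simp
  then show ?thesis
    unfolding k_eq_0 by (simp add: cycle_factor_def Psi2_iff Psi3_iff Psi4_iff)
qed

lemma sq_norm_minor_unicyclic_eq_cycle_factor:
  assumes sub: "finite_substructure W F" and subset: "F \<subseteq> E"
    and uni: "unicyclic (W, F)" and cyc: "cycle_traversal F cs"
  shows "sq_norm_minor (incidence_entry A) W F = cycle_factor A cs"
  using sq_norm_minor_unicyclic[OF sub uni cyc] cycle_traversal_mono[OF cyc subset]
  by (simp add: traversal_gain_incidence_entry sq_norm_one_minus_omega_power_flow)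

text \<open>All traversals of the cycle yield the same minor, and \<^const>\<open>cycle_factor\<close> separates the classes.\<close>

lemma unicyclic_in_iff:
  assumes sub: "finite_substructure W F" and subset: "F \<subseteq> E"
    and uni: "unicyclic (W, F)" and cyc: "cycle_traversal F cs"
    and class_P: "P \<in> {Psi2 A, Psi3 A, Psi4 A}"
  shows "unicyclic_in P (W, F) \<longleftrightarrow> cs \<in> P"
proof
  assume "unicyclic_in P (W, F)"
  then obtain cs' where cs': "cycle_traversal F cs'" "cs' \<in> P" by (auto simp: unicyclic_in_def)
  then have "cycle_factor A cs' = cycle_factor A cs"
    using sq_norm_minor_unicyclic_eq_cycle_factor[OF sub subset uni] cyc by metis
  then show "cs \<in> P"
    using cs'(2) class_P
    by (auto simp: cycle_factor_def Psi2_iff Psi3_iff Psi4_iff split: if_splits)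
next
  assume "cs \<in> P"
  then show "unicyclic_in P (W, F)" using uni cyc by (auto simp: unicyclic_in_def)
qed

end

section \<open>The determinant formula\<close>

definition component_factor :: "('v \<times> 'v) set \<Rightarrow> 'v set \<times> 'v set set \<Rightarrow> real" where
  "component_factor A K =
    (if rootless_tree K \<or> (unicyclic K \<and> \<not> unicyclic_in (Psi4 A) K)
     then (if unicyclic_in (Psi2 A) K then 3 else 1) * (if unicyclic_in (Psi3 A) K then 4 else 1)
     else 0)"

lemma prod_component_factor:
  assumes fin: "finite W" "finite F" and square: "card W = card F"
  shows "(\<Prod>K\<in>components W F. component_factor A K)
    = (if type_II A W F then 3 ^ tau1 A W F * 4 ^ tau2 A W F else 0)"
proof (cases "type_II A W F")
  case True
  then have "component_factor A K
      = (if unicyclic_in (Psi2 A) K then 3 else 1) * (if unicyclic_in (Psi3 A) K then 4 else 1)"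
    if "K \<in> components W F" for K using that by (simp add: component_factor_def type_II_def)
  then have "(\<Prod>K\<in>components W F. component_factor A K)
      = (\<Prod>K\<in>components W F. if unicyclic_in (Psi2 A) K then 3 else 1)
      * (\<Prod>K\<in>components W F. if unicyclic_in (Psi3 A) K then 4 else 1)"
    by (simp flip: prod.distrib)
  also have "\<dots> = 3 ^ tau1 A W F * 4 ^ tau2 A W F"
    using finite_components[OF fin] by (simp add: tau1_def tau2_def flip: prod.inter_filter)
  finally show ?thesis using True by simp
next
  case False
  then obtain K where "K \<in> components W F" "component_factor A K = 0"
    using square by (auto simp: type_II_def square_substructure_def component_factor_def)
  then show ?thesis using False finite_components[OF fin] by auto
qed

context mixed_graph
begin

lemma sq_norm_minor_unicyclic_eq_component_factor:
  assumes sub: "finite_substructure W F" and subset: "F \<subseteq> E" and uni: "unicyclic (W, F)"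
  shows "sq_norm_minor (incidence_entry A) W F = component_factor A (W, F)"
proof -
  obtain cs where cyc: "cycle_traversal F cs" using uni by (auto simp: unicyclic_def cycles_def)
  have "\<not> rootless_tree (W, F)"
    using finite_substructure.rootless_tree_not_unicyclic[OF sub] uni by blast
  then have "component_factor A (W, F) = cycle_factor A cs"
    using uni
    by (simp add: component_factor_def cycle_factor_def unicyclic_in_iff[OF sub subset uni cyc]
        Psi2_iff Psi3_iff Psi4_iff)
  then show ?thesis using sq_norm_minor_unicyclic_eq_cycle_factor[OF sub subset uni cyc] by simp
qed

lemma sq_norm_minor_component:
  assumes fin: "finite W" and subset: "F \<subseteq> E" and comp: "(W', F') \<in> components W F"
  shows "sq_norm_minor (incidence_entry A) W' F' = component_factor A (W', F')"
proof (cases "W' = {}")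
  case True
  then have not_connected: "\<not> rootless_tree (W', F')" "\<not> unicyclic (W', F')"
    by (auto simp: rootless_tree_def tree_graph_def unicyclic_def connected_graph_def)
  have "finite F'" using component_subset[OF comp] subset finite_edges by (metis finite_subset)
  moreover have "F' \<noteq> {}" using component_nonempty[OF comp] True by simp
  ultimately have "card W' \<noteq> card F'" using True by (simp add: card_gt_0_iff)
  with not_connected show ?thesis by (simp add: sq_norm_minor_def component_factor_def)
next
  case False
  have edges: "card e = 2" if "e \<in> F" for e using that subset edge by blast
  have sub: "finite_substructure W' F'"
    using component_finite_substructure[OF comp False fin _ edges] subset finite_edges finite_subset
    by blast
  interpret component: finite_substructure W' F' by fact
  have comp_subset: "F' \<subseteq> E" using component_subset[OF comp] subset by blast
  consider (tree) "rootless_tree (W', F')" | (uni) "unicyclic (W', F')"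
    | (neither) "\<not> rootless_tree (W', F')" "\<not> unicyclic (W', F')" by blast
  then show ?thesis
  proof cases
    case tree
    then have "component_factor A (W', F') = 1"
      using component.rootless_tree_not_unicyclic
      by (simp add: component_factor_def unicyclic_in_def)
    then show ?thesis using sq_norm_minor_rootless_tree[OF sub tree] by simp
  next
    case uni
    then show ?thesis by (rule sq_norm_minor_unicyclic_eq_component_factor[OF sub comp_subset])
  next
    case neither
    then have "card W' \<noteq> card F'"
      using component.square_iff_rootless_tree_or_unicyclic
        component_connected_graph[OF comp False edges] by blast
    then show ?thesis using neither by (simp add: sq_norm_minor_def component_factor_def)
  qed
qed

lemma sq_norm_minor_substructure:
  assumes fin: "finite W" and subset: "F \<subseteq> E" and square: "card F = card W"
  shows "sq_norm_minor (incidence_entry A) W F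
    = (if type_II A W F then 3 ^ tau1 A W F * 4 ^ tau2 A W F else 0)"
proof -
  have fin_edges: "finite F" using subset finite_edges by (rule finite_subset)
  have "sq_norm_minor (incidence_entry A) (\<Union>(fst ` components W F)) (\<Union>(snd ` components W F))
      = (\<Prod>(W', F')\<in>components W F. sq_norm_minor (incidence_entry A) W' F')"
  proof (rule sq_norm_minor_Union)
    show "finite W' \<and> finite F'" if "(W', F') \<in> components W F" for W' F'
      using component_subset[OF that] fin fin_edges by (auto intro: finite_subset)
    show "W1 \<inter> W2 = {} \<and> F1 \<inter> F2 = {} \<and> (\<forall>v\<in>W1. \<forall>e\<in>F2. incidence_entry A v e = 0)"
      if "(W1, F1) \<in> components W F" "(W2, F2) \<in> components W F" "(W1, F1) \<noteq> (W2, F2)"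
        for W1 F1 W2 F2
      using components_disjoint[OF that] components_not_incident[OF that] by (simp add: entry_eq_0)
  qed (rule finite_components[OF fin fin_edges])
  also have "\<dots> = (\<Prod>K\<in>components W F. component_factor A K)"
    by (intro prod.cong refl) (auto simp: sq_norm_minor_component[OF fin subset])
  finally show ?thesis
    unfolding Union_components using prod_component_factor[OF fin fin_edges, of A] square by simp
qed

end

theorem theorem2p8:
  fixes V V1 :: "'v set" and E :: "'v set set" and A :: "('v \<times> 'v) set" and vs :: "'v list"
  assumes "mixed_graph V E A"
    and "distinct vs" and "set vs = V"
    and "V1 \<subseteq> V" and "V1 \<noteq> {}"
  shows "det (principal_submatrix vs (Q_mat vs E A) V1) =
    (\<Sum>E1 | E1 \<subseteq> E \<and> type_II A V1 E1. 3 ^ tau1 A V1 E1 * 4 ^ tau2 A V1 E1)"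
proof -
  interpret mixed_graph V E A by fact
  have "finite V1" using assms(4) finite_verts by (rule finite_subset)
  have "det (principal_submatrix vs (Q_mat vs E A) V1)
      = (\<Sum>E1 | E1 \<subseteq> E \<and> card E1 = card V1.
          complex_of_real (sq_norm_minor (incidence_entry A) V1 E1))"
    using assms(2-4) by (rule det_principal_submatrix_Q_mat)
  also have "\<dots> = (\<Sum>E1 | E1 \<subseteq> E \<and> card E1 = card V1.
      if type_II A V1 E1 then 3 ^ tau1 A V1 E1 * 4 ^ tau2 A V1 E1 else 0)"
    by (intro sum.cong refl) (simp add: sq_norm_minor_substructure[OF \<open>finite V1\<close>])
  also have "\<dots> = (\<Sum>E1 | E1 \<subseteq> E \<and> type_II A V1 E1. 3 ^ tau1 A V1 E1 * 4 ^ tau2 A V1 E1)"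
    using finite_edges
    by (intro sum.mono_neutral_cong_right) (auto simp: type_II_def square_substructure_def)
  finally show ?thesis .
qed

end
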